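(* Suppose that assumptions (L), (V), (TV), (M), (E) of the context hold. Let $\gamma$ denote the constant step size of DiceSGD. If $\gamma\le\frac{1}{2L(1+\sigma_1^2)}$, then the iterates generated by DiceSGD admit the following bound for any $T\ge1$: $$\min_{t=0,\dots,T-1}\mathbb E\big[\|\nabla f(\theta_t;\theta_t)\|^2\big]\le\frac{4\Delta_0}{T\gamma}+\mathsf b\,\beta+2L\gamma\big[\sigma_{\rm DP}^2+\sigma_0^2\big]+2L^2M^2\gamma^2,$$ where $\Delta_0:=\mathbb E[f(\theta_0-\gamma e_0;\theta_0)-\ell^\star]$ is an upper bound for the initial error and the constant $\mathsf b$ is defined as $\mathsf b:=4\ell_{\max}\big(C_1+C_2+\sqrt d\,\sigma_{\rm DP}\big)$. In particular, for sufficiently large $T$, setting $\gamma=1/\sqrt T$ yields $\min_{t=0,\dots,T-1}\mathbb E[\|\nabla f(\theta_t;\theta_t)\|^2]=\mathcal O\big(\tfrac1{\sqrt T}+\mathsf b\,\beta\big)$.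
   Context: Setting. $\mathcal X=\mathbb R^d$, $\mathsf Z$ is the sample space, $\ell(\theta;z)$ is a (possibly non-convex) loss function differentiable in $\theta$, and for each $\theta\in\mathbb R^d$, $\mathcal D(\theta)$ is a probability distribution on $\mathsf Z$. $\nabla\ell(\theta;z)$ is the gradient in $\theta$. Write $f(\theta_1;\theta_2):=\mathbb E_{Z\sim\mathcal D(\theta_2)}[\ell(\theta_1;Z)]$; $\nabla f(\theta_1;\theta_2)$ is the gradient with respect to the first argument. $\|\cdot\|$ is the Euclidean norm. Clipping: $\mathrm{clip}_c(g):=\min\{1,c/\|g\|\}\,g$ for $g\in\mathbb R^d$. DiceSGD with greedy deployment (constant step size $\gamma$): parameters $C_1$, $C_2$ with $C_2\ge C_1$, and $\sigma_{\rm DP}^2$; initialization $\theta_0$ and $e_0=0$. For $t=0,\dots,T-1$: draw a new sample $Z_{t+1}\sim\mathcal D(\theta_t)$ and Gaussian noise $\zeta_{t+1}\sim\mathcal N(0,\sigma_{\rm DP}^2I_d)$; set $v_{t+1}=\mathrm{clip}_{C_1}(\nabla\ell(\theta_t;Z_{t+1}))+\mathrm{clip}_{C_2}(e_t)$, $\theta_{t+1}=\theta_t-\gamma(v_{t+1}+\zeta_{t+1})$, $e_{t+1}=e_t+\nabla\ell(\theta_t;Z_{t+1})-v_{t+1}$. Assumptions: (L) $\|\nabla\ell(\theta_1;z_1)-\nabla\ell(\theta_2;z_2)\|\le L(\|\theta_1-\theta_2\|+\|z_1-z_2\|)$ for all $\theta_1,\theta_2\in\mathcal X$, $z_1,z_2\in\mathsf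 Z$; and there is a constant $\ell^\star>-\infty$ with $\ell(\theta;z)\ge\ell^\star$ for any $\theta\in\mathcal X$. (V) There are $\sigma_0,\sigma_1\ge0$ such that $\mathbb E_{Z\sim\mathcal D(\theta_2)}[\|\nabla\ell(\theta_1;Z)-\nabla f(\theta_1;\theta_2)\|^2]\le\sigma_0^2+\sigma_1^2\|\nabla f(\theta_1;\theta_2)\|^2$ for all $\theta_1,\theta_2\in\mathcal X$. (TV) There is $\beta\ge0$ with $d_{TV}(\mathcal D(\theta),\mathcal D(\theta'))\le\beta\|\theta-\theta'\|$ for all $\theta,\theta'\in\mathcal X$, where $d_{TV}$ is the total variation distance. (M) There is a constant $\ell_{\max}\ge0$ with $\sup_{\theta\in\mathbb R^d,z\in\mathsf Z}|\ell(\theta;z)|\le\ell_{\max}$. (E) There is a constant $M$ such that $\mathbb E[\|e_t\|^2]\le M^2$ for any $t\ge1$.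
   Formalization: The noise term 2Lγ[σ_DP² + σ_0²] is replaced by 2Lγ[d·σ_DP² + σ_0²], since E‖ζ‖² = d·σ_DP² for ζ ~ N(0, σ_DP² I_d); the printed bound without the factor d fails for large d (e.g. d = 100). *)

theory Defs
  imports "HOL-Probability.Probability"
begin

text \<open>Throughout, \<open>'a\<close> plays the role of \<open>\<real>\<^sup>d\<close> with \<open>d = DIM('a)\<close>, and the sample space is a set
  \<open>S\<close> in a separable normed space \<open>'z\<close>, equipped with its Borel sets.\<close>

definition grad :: "('a::euclidean_space \<Rightarrow> real) \<Rightarrow> 'a \<Rightarrow> 'a" where
  "grad f x = (THE g. GDERIV f x :> g)"

definition clip :: "real \<Rightarrow> 'a::euclidean_space \<Rightarrow> 'a" where
  "clip c g = min 1 (c / norm g) *\<^sub>R g"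

definition tv_dist :: "'z measure \<Rightarrow> 'z measure \<Rightarrow> real" where
  "tv_dist P Q = (SUP A\<in>sets P. \<bar>measure P A - measure Q A\<bar>)"

text \<open>The law \<open>N(0, \<sigma>\<^sup>2 I)\<close>: independent \<open>N(0, \<sigma>\<^sup>2)\<close> coordinates in the orthonormal basis; for
  \<open>\<sigma> = 0\<close> this is the point mass at the origin.  Its second moment \<open>E \<parallel>\<zeta>\<parallel>\<^sup>2\<close> is \<open>DIM('a) * \<sigma>\<^sup>2\<close>.\<close>

definition isotropic_gaussian :: "real \<Rightarrow> 'a::euclidean_space measure" where
  "isotropic_gaussian \<sigma> =
     distr (\<Pi>\<^sub>M b\<in>Basis. density lborel std_normal_density) borel
       (\<lambda>x. \<Sum>b\<in>Basis. (\<sigma> * x b) *\<^sub>R b)"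

definition risk :: "('a::euclidean_space \<Rightarrow> 'z \<Rightarrow> real) \<Rightarrow> ('a \<Rightarrow> 'z measure) \<Rightarrow> 'a \<Rightarrow> 'a \<Rightarrow> real" where
  "risk l D \<theta>\<^sub>1 \<theta>\<^sub>2 = (\<integral>z. l \<theta>\<^sub>1 z \<partial>D \<theta>\<^sub>2)"

definition loss_grad :: "('a::euclidean_space \<Rightarrow> 'z \<Rightarrow> real) \<Rightarrow> 'a \<Rightarrow> 'z \<Rightarrow> 'a" where
  "loss_grad l \<theta> z = grad (\<lambda>x. l x z) \<theta>"

text \<open>The gradient of the risk is taken in its first argument only.\<close>

definition risk_grad :: "('a::euclidean_space \<Rightarrow> 'z \<Rightarrow> real) \<Rightarrow> ('a \<Rightarrow> 'z measure) \<Rightarrow> 'a \<Rightarrow> 'a \<Rightarrow> 'a" where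
  "risk_grad l D \<theta>\<^sub>1 \<theta>\<^sub>2 = grad (\<lambda>x. risk l D x \<theta>\<^sub>2) \<theta>\<^sub>1"

text \<open>Measurability of the loss in \<open>z\<close> is what makes the risk meaningful.\<close>

definition performative_model ::
  "'z::{real_normed_vector, second_countable_topology} set \<Rightarrow>
   ('a::euclidean_space \<Rightarrow> 'z \<Rightarrow> real) \<Rightarrow> ('a \<Rightarrow> 'z measure) \<Rightarrow> bool" where
  "performative_model S l D \<longleftrightarrow>
     (\<forall>\<theta>. prob_space (D \<theta>) \<and> sets (D \<theta>) = sets (restrict_space borel S)) \<and>
     (\<forall>\<theta>. l \<theta> \<in> borel_measurable (restrict_space borel S)) \<and>
     (\<forall>\<theta>. \<forall>z\<in>S. (\<lambda>x. l x z) differentiable (at \<theta>))"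

definition smooth_loss ::
  "'z::real_normed_vector set \<Rightarrow> ('a::euclidean_space \<Rightarrow> 'z \<Rightarrow> real) \<Rightarrow> real \<Rightarrow> real \<Rightarrow> bool" where
  "smooth_loss S l L l_inf \<longleftrightarrow> 0 < L \<and>
     (\<forall>\<theta>\<^sub>1 \<theta>\<^sub>2. \<forall>z\<^sub>1\<in>S. \<forall>z\<^sub>2\<in>S.
        norm (loss_grad l \<theta>\<^sub>1 z\<^sub>1 - loss_grad l \<theta>\<^sub>2 z\<^sub>2) \<le> L * (norm (\<theta>\<^sub>1 - \<theta>\<^sub>2) + norm (z\<^sub>1 - z\<^sub>2))) \<and>
     (\<forall>\<theta>. \<forall>z\<in>S. l_inf \<le> l \<theta> z)"

text \<open>The integrals here and in \<open>risk\<close> never take the junk value 0: a bounded loss with Lipschitz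
  gradient has a bounded gradient, which is continuous in \<open>z\<close>.\<close>

definition bounded_variance ::
  "('a::euclidean_space \<Rightarrow> 'z \<Rightarrow> real) \<Rightarrow> ('a \<Rightarrow> 'z measure) \<Rightarrow> real \<Rightarrow> real \<Rightarrow> bool" where
  "bounded_variance l D \<sigma>\<^sub>0 \<sigma>\<^sub>1 \<longleftrightarrow> 0 \<le> \<sigma>\<^sub>0 \<and> 0 \<le> \<sigma>\<^sub>1 \<and>
     (\<forall>\<theta>\<^sub>1 \<theta>\<^sub>2. (\<integral>z. (norm (loss_grad l \<theta>\<^sub>1 z - risk_grad l D \<theta>\<^sub>1 \<theta>\<^sub>2))\<^sup>2 \<partial>D \<theta>\<^sub>2)
        \<le> \<sigma>\<^sub>0\<^sup>2 + \<sigma>\<^sub>1\<^sup>2 * (norm (risk_grad l D \<theta>\<^sub>1 \<theta>\<^sub>2))\<^sup>2)"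

definition tv_sensitive :: "('a::euclidean_space \<Rightarrow> 'z measure) \<Rightarrow> real \<Rightarrow> bool" where
  "tv_sensitive D \<beta> \<longleftrightarrow> 0 \<le> \<beta> \<and> (\<forall>\<theta> \<theta>'. tv_dist (D \<theta>) (D \<theta>') \<le> \<beta> * norm (\<theta> - \<theta>'))"

definition bounded_loss :: "'z set \<Rightarrow> ('a::euclidean_space \<Rightarrow> 'z \<Rightarrow> real) \<Rightarrow> real \<Rightarrow> bool" where
  "bounded_loss S l l_max \<longleftrightarrow> 0 \<le> l_max \<and> (\<forall>\<theta>. \<forall>z\<in>S. \<bar>l \<theta> z\<bar> \<le> l_max)"

definition performative_assms ::
  "'z::{real_normed_vector, second_countable_topology} set \<Rightarrow>
   ('a::euclidean_space \<Rightarrow> 'z \<Rightarrow> real) \<Rightarrow> ('a \<Rightarrow> 'z measure) \<Rightarrow>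
   real \<Rightarrow> real \<Rightarrow> real \<Rightarrow> real \<Rightarrow> real \<Rightarrow> real \<Rightarrow> bool" where
  "performative_assms S l D L l_inf \<sigma>\<^sub>0 \<sigma>\<^sub>1 \<beta> l_max \<longleftrightarrow>
     performative_model S l D \<and> smooth_loss S l L l_inf \<and> bounded_variance l D \<sigma>\<^sub>0 \<sigma>\<^sub>1 \<and>
     tv_sensitive D \<beta> \<and> bounded_loss S l l_max"

text \<open>\<open>T\<close> steps of DiceSGD on a probability space \<open>\<Omega>\<close> with history \<open>F\<close>.  Drawing the sample
  \<open>Z (t+1)\<close> from \<open>D (\<theta> t)\<close> and, independently, fresh noise \<open>\<zeta> (t+1)\<close> means: conditionally on \<open>F t\<close>,
  the pair has law \<open>D (\<theta> t)\<close> times \<open>isotropic_gaussian \<sigma>\<close> (stated on rectangles).  The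
  initialization \<open>\<theta> 0\<close> may be random.\<close>

definition dice_sgd ::
  "'w measure \<Rightarrow> (nat \<Rightarrow> 'w measure) \<Rightarrow>
   'z::{real_normed_vector, second_countable_topology} set \<Rightarrow>
   ('a::euclidean_space \<Rightarrow> 'z \<Rightarrow> real) \<Rightarrow> ('a \<Rightarrow> 'z measure) \<Rightarrow>
   real \<Rightarrow> real \<Rightarrow> real \<Rightarrow> real \<Rightarrow> nat \<Rightarrow>
   (nat \<Rightarrow> 'w \<Rightarrow> 'a) \<Rightarrow> (nat \<Rightarrow> 'w \<Rightarrow> 'a) \<Rightarrow> (nat \<Rightarrow> 'w \<Rightarrow> 'z) \<Rightarrow> (nat \<Rightarrow> 'w \<Rightarrow> 'a) \<Rightarrow> bool" where
  "dice_sgd \<Omega> F S l D \<gamma> C\<^sub>1 C\<^sub>2 \<sigma> T \<theta> e Z \<zeta> \<longleftrightarrow>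
     0 < \<gamma> \<and> 0 \<le> C\<^sub>1 \<and> C\<^sub>1 \<le> C\<^sub>2 \<and> 0 \<le> \<sigma> \<and>
     prob_space \<Omega> \<and> filtration (space \<Omega>) F \<and> (\<forall>t. subalgebra \<Omega> (F t)) \<and>
     \<theta> 0 \<in> borel_measurable (F 0) \<and> (\<forall>\<omega>\<in>space \<Omega>. e 0 \<omega> = 0) \<and>
     (\<forall>t<T.
        Z (Suc t) \<in> measurable (F (Suc t)) (restrict_space borel S) \<and>
        \<zeta> (Suc t) \<in> borel_measurable (F (Suc t)) \<and>
        (\<forall>A\<in>sets (restrict_space borel S). \<forall>B\<in>sets borel. AE \<omega> in \<Omega>.
           real_cond_exp \<Omega> (F t) (\<lambda>\<omega>'. indicator A (Z (Suc t) \<omega>') * indicator B (\<zeta> (Suc t) \<omega>')) \<omega>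
             = measure (D (\<theta> t \<omega>)) A * measure (isotropic_gaussian \<sigma>) B) \<and>
        (\<forall>\<omega>\<in>space \<Omega>.
           let g = loss_grad l (\<theta> t \<omega>) (Z (Suc t) \<omega>);
               v = clip C\<^sub>1 g + clip C\<^sub>2 (e t \<omega>)
           in \<theta> (Suc t) \<omega> = \<theta> t \<omega> - \<gamma> *\<^sub>R (v + \<zeta> (Suc t) \<omega>) \<and>
              e (Suc t) \<omega> = e t \<omega> + g - v))"

definition bounded_error ::
  "'w measure \<Rightarrow> (nat \<Rightarrow> 'w \<Rightarrow> 'a::euclidean_space) \<Rightarrow> nat \<Rightarrow> real \<Rightarrow> bool" where
  "bounded_error \<Omega> e T M \<longleftrightarrow>
     (\<forall>t\<in>{1..T}. integrable \<Omega> (\<lambda>\<omega>. (norm (e t \<omega>))\<^sup>2) \<and> (\<integral>\<omega>. (norm (e t \<omega>))\<^sup>2 \<partial>\<Omega>) \<le> M\<^sup>2)"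

definition min_sq_grad ::
  "'w measure \<Rightarrow> ('a::euclidean_space \<Rightarrow> 'z \<Rightarrow> real) \<Rightarrow> ('a \<Rightarrow> 'z measure) \<Rightarrow>
   (nat \<Rightarrow> 'w \<Rightarrow> 'a) \<Rightarrow> nat \<Rightarrow> real" where
  "min_sq_grad \<Omega> l D \<theta> T =
     Min ((\<lambda>t. \<integral>\<omega>. (norm (risk_grad l D (\<theta> t \<omega>) (\<theta> t \<omega>)))\<^sup>2 \<partial>\<Omega>) ` {..<T})"

definition init_gap ::
  "'w measure \<Rightarrow> ('a::euclidean_space \<Rightarrow> 'z \<Rightarrow> real) \<Rightarrow> ('a \<Rightarrow> 'z measure) \<Rightarrow> real \<Rightarrow>
   real \<Rightarrow> (nat \<Rightarrow> 'w \<Rightarrow> 'a) \<Rightarrow> (nat \<Rightarrow> 'w \<Rightarrow> 'a) \<Rightarrow> real" where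
  "init_gap \<Omega> l D l_inf \<gamma> \<theta> e =
     (\<integral>\<omega>. risk l D (\<theta> 0 \<omega> - \<gamma> *\<^sub>R e 0 \<omega>) (\<theta> 0 \<omega>) - l_inf \<partial>\<Omega>)"

definition bias_const :: "'a::euclidean_space itself \<Rightarrow> real \<Rightarrow> real \<Rightarrow> real \<Rightarrow> real \<Rightarrow> real" where
  "bias_const TYPE('a) l_max C\<^sub>1 C\<^sub>2 \<sigma> = 4 * l_max * (C\<^sub>1 + C\<^sub>2 + sqrt (real DIM('a)) * \<sigma>)"

end

theory Submission
  imports Defs
begin

text \<open>The proof follows a virtual iterate.  Error feedback makes \<open>x t = \<theta> t - \<gamma> e t\<close> satisfy
  \<open>x (t+1) = x t - \<gamma> (g + \<zeta>)\<close> with the unclipped stochastic gradient \<open>g\<close> at \<open>\<theta> t\<close>: whatever clipping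
  removes from a step is stored in \<open>e\<close> and does not affect \<open>x\<close>.  The potential is the risk of \<open>x t\<close>
  under the distribution deployed at \<open>\<theta> t\<close>.  In one step it changes for two reasons.

  With the distribution fixed, \<open>x\<close> makes a step of stochastic gradient descent on a smooth
  function, except that the gradient is sampled at \<open>\<theta> t\<close> and not at \<open>x t\<close>; the two points differ by
  \<open>\<gamma> e t\<close>.  Young's inequality trades this mismatch for a quarter of the squared gradient plus
  \<open>L\<^sup>2 \<gamma>\<^sup>2 (norm (e t))\<^sup>2\<close>, and the step size makes the second-order term cost another quarter, so the
  expected potential still decreases by \<open>\<gamma> / 2\<close> times the squared gradient up to the error terms.

  Then the distribution changes from that of \<open>\<theta> t\<close> to that of \<open>\<theta> (t+1)\<close>.  The loss has oscillation at
  most \<open>2 * l_max\<close>, so the potential grows by at most \<open>2 * l_max * \<beta>\<close> times the displacement of \<open>\<theta>\<close>, and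
  clipping bounds the expected displacement by \<open>\<gamma> (C\<^sub>1 + C\<^sub>2 + sqrt d * \<sigma>)\<close>.  Dividing by \<open>\<gamma> / 2\<close> gives
  the factor \<open>4 * l_max\<close> of the bias.

  The lemma \<open>expected_potential_dice_step_le\<close> combines both effects for a fixed state \<open>(\<theta>, e)\<close>, as an
  inequality between integrals over one draw.  By \<open>integral_conditional_law\<close> it may be averaged over
  the random state, and the resulting inequalities telescope because the potential is bounded below.\<close>

section \<open>Total variation and bounded expectations\<close>

lemma tv_dist_ge:
  assumes "prob_space P" "prob_space Q" "A \<in> sets P"
  shows "\<bar>measure P A - measure Q A\<bar> \<le> tv_dist P Q"
proof -
  interpret P: prob_space P by fact
  interpret Q: prob_space Q by fact
  have "\<bar>measure P B - measure Q B\<bar> \<le> 1" for B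
    using P.prob_le_1[of B] Q.prob_le_1[of B] measure_nonneg[of P B] measure_nonneg[of Q B]
    by linarith
  hence "bdd_above ((\<lambda>A. \<bar>measure P A - measure Q A\<bar>) ` sets P)"
    by (intro bdd_aboveI2[where M = 1])
  thus ?thesis
    unfolding tv_dist_def using assms(3) by (rule cSUP_upper2[OF _ _ order_refl])
qed

text \<open>A layer-cake argument: \<open>h\<close> is within \<open>1 / n\<close> of the average of the indicators of its
  superlevel sets at heights \<open>k / n\<close>, and on each of these sets the two probabilities differ by
  at most the total variation.\<close>

lemma expectation_diff_le_tv_dist_01:
  fixes h :: "'z \<Rightarrow> real"
  assumes P: "prob_space P" and Q: "prob_space Q" and PQ: "sets P = sets Q"
    and h: "h \<in> borel_measurable P" and h01: "\<And>z. z \<in> space P \<Longrightarrow> 0 \<le> h z \<and> h z \<le> 1"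
  shows "(\<integral>z. h z \<partial>P) - (\<integral>z. h z \<partial>Q) \<le> tv_dist P Q"
proof -
  interpret P: prob_space P by fact
  interpret Q: prob_space Q by fact
  have sp: "space P = space Q" using PQ by (rule sets_eq_imp_space_eq)
  have hQ: "h \<in> borel_measurable Q" using h by (simp add: measurable_cong_sets[OF PQ refl])
  have intP: "integrable P h" by (rule P.integrable_const_bound[of _ 1]) (use h h01 in auto)
  have intQ: "integrable Q h" by (rule Q.integrable_const_bound[of _ 1]) (use hQ h01 sp in auto)
  have step: "(\<integral>z. h z \<partial>P) - (\<integral>z. h z \<partial>Q) \<le> tv_dist P Q + 1 / real n" if "0 < n" for n :: nat
  proof -
    define A where "A k = {z \<in> space P. real k \<le> real n * h z}" for k
    define h' where "h' z = (\<Sum>k=1..n. indicator (A k) z :: real) / real n" for z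
    have A: "A k \<in> sets P" for k unfolding A_def using h by measurable
    have AQ: "A k \<in> sets Q" for k using A PQ by simp
    have count: "real n * h' z = real_of_int \<lfloor>real n * h z\<rfloor>" if z: "z \<in> space P" for z
    proof -
      have up: "real n * h z \<le> real n" using h01[OF z] by (simp add: mult_left_le)
      have pos: "0 \<le> real n * h z" using h01[OF z] by simp
      have "(\<Sum>k=1..n. indicator (A k) z :: real) = real (card ({1..n} \<inter> {k. z \<in> A k}))"
        unfolding indicator_def by simp
      also have "{1..n} \<inter> {k. z \<in> A k} = {1..nat \<lfloor>real n * h z\<rfloor>}"
      proof -
        have "k \<le> nat \<lfloor>real n * h z\<rfloor> \<longleftrightarrow> real k \<le> real n * h z" for k
          using pos by (simp add: le_nat_iff le_floor_iff)
        moreover have "k \<le> n" if "real k \<le> real n * h z" for k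
          using that up by linarith
        ultimately show ?thesis using z unfolding A_def by auto
      qed
      finally show ?thesis using \<open>0 < n\<close> pos by (simp add: h'_def)
    qed
    have le: "h' z \<le> h z" and ge: "h z \<le> h' z + 1 / real n" if z: "z \<in> space P" for z
    proof -
      have "real n * h' z \<le> real n * h z" "real n * h z \<le> real n * (h' z + 1 / real n)"
        using count[OF z] \<open>0 < n\<close> by (simp_all add: distrib_left)
      thus "h' z \<le> h z" "h z \<le> h' z + 1 / real n"
        using \<open>0 < n\<close> by simp_all
    qed
    have ih'P: "integrable P h'" and ih'Q: "integrable Q h'"
      unfolding h'_def using A AQ
      by (auto intro!: integrable_divide_zero Bochner_Integration.integrable_sum
          simp: P.emeasure_eq_measure Q.emeasure_eq_measure)
    have eP: "(\<integral>z. h' z \<partial>P) = (\<Sum>k=1..n. measure P (A k)) / real n"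
      unfolding h'_def using A by (simp add: P.emeasure_eq_measure)
    have eQ: "(\<integral>z. h' z \<partial>Q) = (\<Sum>k=1..n. measure Q (A k)) / real n"
      unfolding h'_def using AQ by (simp add: Q.emeasure_eq_measure)
    have "(\<integral>z. h z \<partial>P) \<le> (\<integral>z. h' z + 1 / real n \<partial>P)"
      using ge intP ih'P by (intro integral_mono) auto
    also have "\<dots> = (\<integral>z. h' z \<partial>P) + 1 / real n"
      using ih'P by (simp add: P.prob_space)
    finally have 1: "(\<integral>z. h z \<partial>P) \<le> (\<integral>z. h' z \<partial>P) + 1 / real n" .
    have 2: "(\<integral>z. h' z \<partial>Q) \<le> (\<integral>z. h z \<partial>Q)"
      using le intQ ih'Q sp by (intro integral_mono) auto
    have "(\<Sum>k=1..n. measure P (A k)) - (\<Sum>k=1..n. measure Q (A k))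
        = (\<Sum>k=1..n. measure P (A k) - measure Q (A k))"
      by (simp add: sum_subtractf)
    also have "\<dots> \<le> (\<Sum>k=1..n. tv_dist P Q)"
      by (intro sum_mono) (use tv_dist_ge[OF P Q A] in \<open>auto simp: abs_le_iff\<close>)
    finally have "(\<integral>z. h' z \<partial>P) - (\<integral>z. h' z \<partial>Q) \<le> tv_dist P Q"
      unfolding eP eQ using \<open>0 < n\<close> by (simp add: field_simps)
    thus ?thesis using 1 2 by linarith
  qed
  have "(\<lambda>n. tv_dist P Q + 1 / real n) \<longlonglongrightarrow> tv_dist P Q + 0"
    by (intro tendsto_intros lim_1_over_n)
  hence "(\<integral>z. h z \<partial>P) - (\<integral>z. h z \<partial>Q) \<le> tv_dist P Q + 0"
    by (rule Lim_bounded2[where N = 1]) (use step in auto)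
  thus ?thesis by simp
qed

lemma expectation_diff_le_tv_dist:
  fixes h :: "'z \<Rightarrow> real"
  assumes P: "prob_space P" and Q: "prob_space Q" and PQ: "sets P = sets Q"
    and h: "h \<in> borel_measurable P" and hab: "\<And>z. z \<in> space P \<Longrightarrow> a \<le> h z \<and> h z \<le> b"
    and ab: "a \<le> b"
  shows "(\<integral>z. h z \<partial>P) - (\<integral>z. h z \<partial>Q) \<le> (b - a) * tv_dist P Q"
proof -
  interpret P: prob_space P by fact
  interpret Q: prob_space Q by fact
  have sp: "space P = space Q" using PQ by (rule sets_eq_imp_space_eq)
  have hQ: "h \<in> borel_measurable Q" using h by (simp add: measurable_cong_sets[OF PQ refl])
  define h' where "h' z = (h z - a) / (b - a)" for z
  have h': "h' \<in> borel_measurable P" unfolding h'_def using h by measurable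
  have h'Q: "h' \<in> borel_measurable Q" unfolding h'_def using hQ by measurable
  have h'01: "0 \<le> h' z \<and> h' z \<le> 1" if "z \<in> space P" for z
    unfolding h'_def using hab[OF that] by (auto simp: divide_simps)
  \<comment> \<open>This also holds if \<open>a = b\<close>, because then both sides are \<open>a\<close>.\<close>
  have eq: "h z = a + (b - a) * h' z" if "z \<in> space P" for z
    unfolding h'_def using hab[OF that] by auto
  have "integrable P h'" by (rule P.integrable_const_bound[of _ 1]) (use h' h'01 in auto)
  hence 1: "(\<integral>z. h z \<partial>P) = a + (b - a) * (\<integral>z. h' z \<partial>P)"
    by (subst Bochner_Integration.integral_cong[OF refl eq]) (auto simp: P.prob_space)
  have "integrable Q h'" by (rule Q.integrable_const_bound[of _ 1]) (use h'Q h'01 sp in auto)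
  hence 2: "(\<integral>z. h z \<partial>Q) = a + (b - a) * (\<integral>z. h' z \<partial>Q)"
    by (subst Bochner_Integration.integral_cong[OF refl eq]) (auto simp: Q.prob_space sp)
  have "(\<integral>z. h' z \<partial>P) - (\<integral>z. h' z \<partial>Q) \<le> tv_dist P Q"
    by (rule expectation_diff_le_tv_dist_01[OF P Q PQ h' h'01])
  from mult_left_mono[OF this, of "b - a"] show ?thesis
    unfolding 1 2 using ab by (simp add: right_diff_distrib)
qed

section \<open>Clipping and gradients\<close>

lemma norm_clip_le:
  assumes "0 \<le> c"
  shows "norm (clip c g) \<le> c"
proof (cases "g = 0")
  case False
  hence "norm (clip c g) = min 1 (c / norm g) * norm g"
    using assms by (simp add: clip_def)
  also have "\<dots> \<le> (c / norm g) * norm g"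
    by (intro mult_right_mono) auto
  finally show ?thesis using False by simp
qed (use assms in \<open>simp add: clip_def\<close>)

lemma borel_measurable_clip [measurable]: "clip c \<in> borel_measurable borel"
  unfolding clip_def by measurable

lemma GDERIV_unique:
  fixes f :: "'a::real_inner \<Rightarrow> real"
  assumes "GDERIV f x :> g" "GDERIV f x :> g'"
  shows "g = g'"
proof -
  have "(\<lambda>h. inner h g) = (\<lambda>h. inner h g')"
    using assms unfolding gderiv_def by (rule has_derivative_unique)
  hence "inner (g - g') (g - g') = 0"
    using fun_cong[of "\<lambda>h. inner h g" "\<lambda>h. inner h g'" "g - g'"] by (simp add: inner_diff_right)
  thus ?thesis by simp
qed

lemma grad_eqI: "GDERIV f x :> g \<Longrightarrow> grad f x = g"
  unfolding grad_def using GDERIV_unique by (blast intro: the_equality)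

lemma GDERIV_grad:
  fixes f :: "'a::euclidean_space \<Rightarrow> real"
  assumes "f differentiable (at x)"
  shows "GDERIV f x :> grad f x"
proof -
  from assms obtain f' where f': "(f has_derivative f') (at x)"
    by (auto simp: differentiable_def)
  interpret f': linear f' using f' by (rule has_derivative_linear)
  have "f' = (\<lambda>h. inner h (\<Sum>b\<in>Basis. f' b *\<^sub>R b))"
  proof
    fix h
    have "f' h = f' (\<Sum>b\<in>Basis. inner h b *\<^sub>R b)" by (simp add: euclidean_representation)
    also have "\<dots> = inner h (\<Sum>b\<in>Basis. f' b *\<^sub>R b)"
      by (simp add: f'.sum f'.scale inner_sum_right mult.commute)
    finally show "f' h = \<dots>" .
  qed
  hence "GDERIV f x :> (\<Sum>b\<in>Basis. f' b *\<^sub>R b)"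
    using f' unfolding gderiv_def by metis
  thus ?thesis using grad_eqI by metis
qed

text \<open>This identifies the gradient of an integral without interchanging limits and integration: a
  quadratic bound on the Taylor remainder of the integrand survives integration.\<close>

lemma GDERIV_of_quadratic_remainder:
  fixes f :: "'a::real_inner \<Rightarrow> real"
  assumes "\<And>y. \<bar>f y - f x - inner g (y - x)\<bar> \<le> K * (norm (y - x))\<^sup>2"
  shows "GDERIV f x :> g"
  unfolding gderiv_def
proof (rule has_derivativeI)
  show "bounded_linear (\<lambda>h. inner h g)" by (rule bounded_linear_inner_left)
  have lim: "((\<lambda>y. K * norm (y - x)) \<longlongrightarrow> K * norm (x - x)) (at x)"
    by (intro tendsto_intros)
  show "((\<lambda>y. (f y - f x - inner (y - x) g) /\<^sub>R norm (y - x)) \<longlongrightarrow> 0) (at x)"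
  proof (rule Lim_null_comparison[OF _ lim[simplified]])
    show "\<forall>\<^sub>F y in at x. norm ((f y - f x - inner (y - x) g) /\<^sub>R norm (y - x)) \<le> K * norm (y - x)"
    proof (intro always_eventually allI)
      fix y
      show "norm ((f y - f x - inner (y - x) g) /\<^sub>R norm (y - x)) \<le> K * norm (y - x)"
      proof (cases "y = x")
        case False
        thus ?thesis using assms[of y]
          by (simp add: inner_commute field_simps power2_eq_square)
      qed simp
    qed
  qed
qed

text \<open>Along the segment from \<open>x\<close> to \<open>y\<close>, the difference of the two sides is monotone, because the
  Lipschitz condition controls the sign of its derivative.\<close>

lemma lipschitz_gradient_upper_bound:
  fixes f :: "'a::real_inner \<Rightarrow> real"
  assumes f: "\<And>u. GDERIV f u :> g u" and g: "\<And>u v. norm (g u - g v) \<le> K * norm (u - v)"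
  shows "f y \<le> f x + inner (g x) (y - x) + K / 2 * (norm (y - x))\<^sup>2"
proof -
  define d where "d = y - x"
  define \<phi> where "\<phi> t = f (x + t *\<^sub>R d) - t * inner (g x) d - K / 2 * (t\<^sup>2 * (norm d)\<^sup>2)" for t
  define \<phi>' where "\<phi>' t = inner (g (x + t *\<^sub>R d) - g x) d - K * t * (norm d)\<^sup>2" for t
  have der: "(\<phi> has_real_derivative \<phi>' t) (at t)" for t
  proof -
    have "((\<lambda>t. f (x + t *\<^sub>R d)) has_derivative (\<lambda>h. inner (h *\<^sub>R d) (g (x + t *\<^sub>R d)))) (at t)"
      by (rule has_derivative_compose[of "\<lambda>t. x + t *\<^sub>R d" "\<lambda>h. h *\<^sub>R d" t UNIV f])
         (use f[of "x + t *\<^sub>R d", unfolded gderiv_def] in \<open>auto intro!: derivative_eq_intros\<close>)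
    hence "((\<lambda>t. f (x + t *\<^sub>R d)) has_real_derivative inner (g (x + t *\<^sub>R d)) d) (at t)"
      unfolding has_field_derivative_def
      by (rule has_derivative_eq_rhs) (auto simp: inner_commute mult.commute)
    thus ?thesis unfolding \<phi>_def \<phi>'_def
      by (auto intro!: derivative_eq_intros simp: inner_diff_left)
  qed
  have "\<phi> 1 \<le> \<phi> 0"
  proof (rule DERIV_nonpos_imp_nonincreasing[of 0 1])
    fix t :: real assume t: "0 \<le> t" "t \<le> 1"
    have "inner (g (x + t *\<^sub>R d) - g x) d \<le> norm (g (x + t *\<^sub>R d) - g x) * norm d"
      by (rule norm_cauchy_schwarz)
    also have "\<dots> \<le> K * norm (t *\<^sub>R d) * norm d"
      using g[of "x + t *\<^sub>R d" x] by (intro mult_right_mono) auto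
    also have "\<dots> = K * t * (norm d)\<^sup>2" using t by (simp add: power2_eq_square)
    finally have "\<phi>' t \<le> 0" unfolding \<phi>'_def by simp
    thus "\<exists>y. (\<phi> has_real_derivative y) (at t) \<and> y \<le> 0" using der by blast
  qed auto
  thus ?thesis unfolding \<phi>_def d_def by simp
qed

lemma lipschitz_gradient_lower_bound:
  fixes f :: "'a::real_inner \<Rightarrow> real"
  assumes f: "\<And>u. GDERIV f u :> g u" and g: "\<And>u v. norm (g u - g v) \<le> K * norm (u - v)"
  shows "f x + inner (g x) (y - x) - K / 2 * (norm (y - x))\<^sup>2 \<le> f y"
  using lipschitz_gradient_upper_bound[of "\<lambda>u. - f u" "\<lambda>u. - g u" K y x] GDERIV_minus[OF f] g
  by (simp add: norm_minus_commute)

text \<open>A gradient step of length \<open>1 / K\<close> decreases \<open>f\<close> by at least \<open>(norm (g x))\<^sup>2 / (2 * K)\<close>, and a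
  function with values in \<open>[- B, B]\<close> cannot decrease by more than \<open>2 * B\<close>.\<close>

lemma sq_norm_gradient_le:
  fixes f :: "'a::real_inner \<Rightarrow> real"
  assumes "0 < K" and f: "\<And>u. GDERIV f u :> g u"
    and g: "\<And>u v. norm (g u - g v) \<le> K * norm (u - v)"
    and B: "\<And>u. \<bar>f u\<bar> \<le> B"
  shows "(norm (g x))\<^sup>2 \<le> 4 * K * B"
proof -
  have "f (x - (1 / K) *\<^sub>R g x) \<le> f x - (1 / K) * (norm (g x))\<^sup>2 + K / 2 * ((1 / K)\<^sup>2 * (norm (g x))\<^sup>2)"
    using lipschitz_gradient_upper_bound[OF f g, of "x - (1 / K) *\<^sub>R g x" x] \<open>0 < K\<close>
    by (simp add: power_mult_distrib power2_norm_eq_inner power_divide)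
  also have "\<dots> = f x - (norm (g x))\<^sup>2 / (2 * K)"
    using \<open>0 < K\<close> by (simp add: field_simps power2_eq_square)
  finally have "(norm (g x))\<^sup>2 / (2 * K) \<le> 2 * B"
    using B[of x] B[of "x - (1 / K) *\<^sub>R g x"] by linarith
  thus ?thesis using \<open>0 < K\<close> by (simp add: field_simps)
qed

section \<open>Integration against a conditional law\<close>

text \<open>If \<open>K\<close> is the conditional law of \<open>X\<close> given \<open>F\<close> and \<open>U\<close> is known at \<open>F\<close>, then a function of
  \<open>(U, X)\<close> may be averaged over \<open>X\<close> first with \<open>U\<close> held fixed.  The conditional law is only
  prescribed on a generating \<open>\<pi>\<close>-system, so the claim is first proved for the joint law of
  \<open>(U, X)\<close> on products with sets of this system; there it is the defining property of
  conditional expectation.  Boundedness of \<open>h\<close> then suffices to pass to integrals.\<close>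

lemma integral_conditional_law:
  fixes h :: "'u \<times> 'x \<Rightarrow> real"
  assumes M: "prob_space M" and sub: "subalgebra M F"
    and U: "U \<in> measurable F N1" and X: "X \<in> measurable M N2"
    and K: "K \<in> measurable F (subprob_algebra N2)"
    and G: "sets N2 = sigma_sets (space N2) G" "Int_stable G" "space N2 \<in> G" "G \<subseteq> Pow (space N2)"
    and law: "\<And>B. B \<in> G \<Longrightarrow>
      AE \<omega> in M. real_cond_exp M F (\<lambda>\<omega>'. indicator B (X \<omega>')) \<omega> = measure (K \<omega>) B"
    and h: "h \<in> borel_measurable (N1 \<Otimes>\<^sub>M N2)"
    and bound: "\<And>y. y \<in> space (N1 \<Otimes>\<^sub>M N2) \<Longrightarrow> \<bar>h y\<bar> \<le> b"
  shows "(\<integral>\<omega>. h (U \<omega>, X \<omega>) \<partial>M) = (\<integral>\<omega>. (\<integral>x. h (U \<omega>, x) \<partial>K \<omega>) \<partial>M)"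
    and "integrable M (\<lambda>\<omega>. \<integral>x. h (U \<omega>, x) \<partial>K \<omega>)"
proof -
  interpret M: prob_space M by fact
  interpret finite_measure_subalgebra M F
    using sub by unfold_locales
  have U_M [measurable]: "U \<in> measurable M N1" by (rule measurable_from_subalg[OF sub U])
  have K_M [measurable]: "K \<in> measurable M (subprob_algebra N2)"
    by (rule measurable_from_subalg[OF sub K])
  note X[measurable]
  have spF: "space F = space M" using sub by (simp add: subalgebra_def)
  have setsK: "sets (K \<omega>) = sets N2" and spaceK: "space (K \<omega>) = space N2"
    and subprobK: "subprob_space (K \<omega>)" if "\<omega> \<in> space M" for \<omega>
    using measurable_space[OF K_M that] by (auto simp: space_subprob_algebra dest: sets_eq_imp_space_eq)
  have ne: "space M \<noteq> {}" by (rule M.not_empty)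
  have G_sets: "B \<in> sets N2" if "B \<in> G" for B using that G(1) by (auto intro: sigma_sets.Basic)
  define \<mu>\<^sub>1 where "\<mu>\<^sub>1 = distr M (N1 \<Otimes>\<^sub>M N2) (\<lambda>\<omega>. (U \<omega>, X \<omega>))"
  define \<kappa> where "\<kappa> \<omega> = distr (K \<omega>) (N1 \<Otimes>\<^sub>M N2) (\<lambda>x. (U \<omega>, x))" for \<omega>
  define \<mu>\<^sub>2 where "\<mu>\<^sub>2 = M \<bind> \<kappa>"
  have \<kappa>: "\<kappa> \<in> measurable M (subprob_algebra (N1 \<Otimes>\<^sub>M N2))"
    unfolding \<kappa>_def by (rule measurable_distr2[OF _ K_M]) measurable
  define E where "E = {C \<times> B | C B. C \<in> sets N1 \<and> B \<in> G}"
  have eq_sets: "sets (N1 \<Otimes>\<^sub>M N2) = sigma_sets (space N1 \<times> space N2) E"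
  proof -
    have "sets (N1 \<Otimes>\<^sub>M N2) = sets (sigma (space N1) (sets N1) \<Otimes>\<^sub>M sigma (space N2) G)"
      using G sets.space_closed[of N1] by (intro sets_pair_measure_cong) auto
    also have "sigma (space N1) (sets N1) \<Otimes>\<^sub>M sigma (space N2) G
        = sigma (space N1 \<times> space N2) E"
      unfolding E_def
    proof (rule sigma_prod)
      show "\<exists>E\<subseteq>sets N1. countable E \<and> space N1 = \<Union> E"
        by (rule exI[of _ "{space N1}"]) auto
      show "\<exists>E\<subseteq>G. countable E \<and> space N2 = \<Union> E"
        using G(3) by (intro exI[of _ "{space N2}"]) auto
    qed (use G sets.space_closed[of N1] in auto)
    also have "sets \<dots> = sigma_sets (space N1 \<times> space N2) E"
      using G(4) sets.space_closed[of N1] by (intro sets_measure_of) (auto simp: E_def)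
    finally show ?thesis .
  qed
  have "\<mu>\<^sub>1 = \<mu>\<^sub>2"
  proof (rule measure_eqI_generator_eq)
    show "Int_stable E"
      unfolding E_def Int_stable_def
    proof safe
      fix C C' B B'
      assume C: "C \<in> sets N1" "C' \<in> sets N1" and B: "B \<in> G" "B' \<in> G"
      have "B \<inter> B' \<in> G" using G(2) B by (simp add: Int_stable_def)
      thus "\<exists>C'' B''. C \<times> B \<inter> C' \<times> B' = C'' \<times> B'' \<and> C'' \<in> sets N1 \<and> B'' \<in> G"
        using C by (intro exI[of _ "C \<inter> C'"] exI[of _ "B \<inter> B'"]) (auto simp: Times_Int_Times)
    qed
    show "E \<subseteq> Pow (space N1 \<times> space N2)"
      using G(4) sets.space_closed[of N1] by (auto simp: E_def)
    show "sets \<mu>\<^sub>1 = sigma_sets (space N1 \<times> space N2) E"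
      by (simp add: \<mu>\<^sub>1_def eq_sets)
    show "sets \<mu>\<^sub>2 = sigma_sets (space N1 \<times> space N2) E"
      unfolding \<mu>\<^sub>2_def by (simp add: sets_bind_measurable[OF \<kappa> ne] eq_sets)
    show "range (\<lambda>_::nat. space N1 \<times> space N2) \<subseteq> E"
      using G(3) by (auto simp: E_def)
    show "(\<Union>i::nat. space N1 \<times> space N2) = space N1 \<times> space N2" by auto
    have "prob_space \<mu>\<^sub>1" unfolding \<mu>\<^sub>1_def by (rule M.prob_space_distr) measurable
    then interpret \<mu>\<^sub>1: prob_space \<mu>\<^sub>1 .
    show "emeasure \<mu>\<^sub>1 (space N1 \<times> space N2) \<noteq> \<infinity>" by (simp add: \<mu>\<^sub>1.emeasure_eq_measure)
  next
    fix Y assume "Y \<in> E"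
    then obtain C B where Y: "Y = C \<times> B" and C [measurable]: "C \<in> sets N1" and B: "B \<in> G"
      by (auto simp: E_def)
    have B' [measurable]: "B \<in> sets N2" by (rule G_sets[OF B])
    have Y' [measurable]: "Y \<in> sets (N1 \<Otimes>\<^sub>M N2)" unfolding Y by measurable
    define A where "A = U -` C \<inter> space F"
    have A: "A \<in> sets F" unfolding A_def by (rule measurable_sets[OF U C])
    hence A_M [measurable]: "A \<in> sets M" using sub by (auto simp: subalgebra_def)
    have [measurable]: "(\<lambda>\<omega>. measure (K \<omega>) B) \<in> borel_measurable M"
      by (rule measurable_compose[OF K_M measurable_measure_subprob_algebra[OF B']])
    have int1: "integrable M (\<lambda>\<omega>. indicator B (X \<omega>) :: real)"
      by (rule M.integrable_const_bound[of _ 1]) (auto intro!: AE_I2 split: split_indicator)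
    have "emeasure \<mu>\<^sub>1 Y = emeasure M {\<omega> \<in> space M. \<omega> \<in> A \<and> X \<omega> \<in> B}"
      unfolding \<mu>\<^sub>1_def
      by (subst emeasure_distr) (auto simp: Y A_def spF intro!: arg_cong2[where f = emeasure])
    also have "\<dots> = measure M {\<omega> \<in> space M. \<omega> \<in> A \<and> X \<omega> \<in> B}"
      by (rule M.emeasure_eq_measure)
    also have "measure M {\<omega> \<in> space M. \<omega> \<in> A \<and> X \<omega> \<in> B}
        = (\<integral>\<omega>. indicator {\<omega> \<in> space M. \<omega> \<in> A \<and> X \<omega> \<in> B} \<omega> \<partial>M)"
      by simp
    also have "\<dots> = (\<integral>\<omega>\<in>A. indicator B (X \<omega>) \<partial>M)"
      unfolding set_lebesgue_integral_def
      by (intro Bochner_Integration.integral_cong) (auto split: split_indicator)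
    also have "\<dots> = (\<integral>\<omega>\<in>A. real_cond_exp M F (\<lambda>\<omega>. indicator B (X \<omega>)) \<omega> \<partial>M)"
      by (rule real_cond_exp_intA[OF int1 A])
    also have "\<dots> = (\<integral>\<omega>\<in>A. measure (K \<omega>) B \<partial>M)"
      using law[OF B] by (intro set_lebesgue_integral_cong_AE) auto
    also have "ennreal \<dots> = (\<integral>\<^sup>+\<omega>. ennreal (indicator A \<omega> * measure (K \<omega>) B) \<partial>M)"
      unfolding set_lebesgue_integral_def
    proof (subst nn_integral_eq_integral)
      show "integrable M (\<lambda>\<omega>. indicator A \<omega> * measure (K \<omega>) B)"
        using subprobK
        by (intro M.integrable_const_bound[of _ 1])
           (auto intro!: AE_I2 subprob_space.subprob_measure_le_1 split: split_indicator)
    qed auto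
    also have "\<dots> = (\<integral>\<^sup>+\<omega>. emeasure (\<kappa> \<omega>) Y \<partial>M)"
    proof (rule nn_integral_cong)
      fix \<omega> assume \<omega>: "\<omega> \<in> space M"
      interpret K: subprob_space "K \<omega>" by (rule subprobK[OF \<omega>])
      have "U \<omega> \<in> space N1" using \<omega> by (rule measurable_space[OF U_M])
      hence "(\<lambda>x. (U \<omega>, x)) \<in> measurable (K \<omega>) (N1 \<Otimes>\<^sub>M N2)"
        by (simp add: measurable_cong_sets[OF setsK[OF \<omega>] refl])
      hence "emeasure (\<kappa> \<omega>) Y = emeasure (K \<omega>) ((\<lambda>x. (U \<omega>, x)) -` Y \<inter> space (K \<omega>))"
        unfolding \<kappa>_def by (rule emeasure_distr) measurable
      also have "(\<lambda>x. (U \<omega>, x)) -` Y \<inter> space (K \<omega>) = (if \<omega> \<in> A then B else {})"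
        using \<omega> G(4) B spaceK[OF \<omega>] by (auto simp: Y A_def spF)
      also have "emeasure (K \<omega>) \<dots> = ennreal (indicator A \<omega> * measure (K \<omega>) B)"
        by (auto simp: K.emeasure_eq_measure)
      finally show "ennreal (indicator A \<omega> * measure (K \<omega>) B) = emeasure (\<kappa> \<omega>) Y" ..
    qed
    also have "\<dots> = emeasure \<mu>\<^sub>2 Y"
      unfolding \<mu>\<^sub>2_def by (rule emeasure_bind[OF ne \<kappa> Y', symmetric])
    finally show "emeasure \<mu>\<^sub>1 Y = emeasure \<mu>\<^sub>2 Y" .
  qed
  have subprob_\<kappa>: "subprob_space (\<kappa> \<omega>)" and sets_\<kappa>: "sets (\<kappa> \<omega>) = sets (N1 \<Otimes>\<^sub>M N2)"
    if "\<omega> \<in> space M" for \<omega>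
    using measurable_space[OF \<kappa> that] by (auto simp: space_subprob_algebra)
  have inner: "(\<integral>y. h y \<partial>\<kappa> \<omega>) = (\<integral>x. h (U \<omega>, x) \<partial>K \<omega>)" if \<omega>: "\<omega> \<in> space M" for \<omega>
  proof -
    have "U \<omega> \<in> space N1" using \<omega> by (rule measurable_space[OF U_M])
    hence "(\<lambda>x. (U \<omega>, x)) \<in> measurable (K \<omega>) (N1 \<Otimes>\<^sub>M N2)"
      by (simp add: measurable_cong_sets[OF setsK[OF \<omega>] refl])
    thus ?thesis unfolding \<kappa>_def using h by (rule integral_distr)
  qed
  have "(\<integral>\<omega>. h (U \<omega>, X \<omega>) \<partial>M) = (\<integral>y. h y \<partial>\<mu>\<^sub>1)"
    unfolding \<mu>\<^sub>1_def using h by (subst integral_distr) auto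
  also have "\<dots> = (\<integral>y. h y \<partial>\<mu>\<^sub>2)" by (simp only: \<open>\<mu>\<^sub>1 = \<mu>\<^sub>2\<close>)
  also have "\<dots> = (\<integral>\<omega>. (\<integral>y. h y \<partial>\<kappa> \<omega>) \<partial>M)"
    unfolding \<mu>\<^sub>2_def
  proof (rule integral_bind[OF h bound \<kappa>, where B' = 1])
    show "finite_measure M" by unfold_locales
    show "AE \<omega> in M. emeasure (\<kappa> \<omega>) (space (\<kappa> \<omega>)) \<le> ennreal 1"
      using subprob_\<kappa> by (auto intro!: AE_I2 subprob_space.emeasure_space_le_1)
  qed
  also have "\<dots> = (\<integral>\<omega>. (\<integral>x. h (U \<omega>, x) \<partial>K \<omega>) \<partial>M)"
    by (intro Bochner_Integration.integral_cong[OF refl] inner)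
  finally show "(\<integral>\<omega>. h (U \<omega>, X \<omega>) \<partial>M) = (\<integral>\<omega>. (\<integral>x. h (U \<omega>, x) \<partial>K \<omega>) \<partial>M)" .
  have "integrable M (\<lambda>\<omega>. \<integral>y. h y \<partial>\<kappa> \<omega>)"
  proof (rule M.integrable_const_bound[of _ "\<bar>b\<bar>"])
    show "(\<lambda>\<omega>. \<integral>y. h y \<partial>\<kappa> \<omega>) \<in> borel_measurable M"
      by (rule measurable_compose[OF \<kappa> integral_measurable_subprob_algebra[OF h]])
    have "norm (\<integral>y. h y \<partial>\<kappa> \<omega>) \<le> \<bar>b\<bar>" if \<omega>: "\<omega> \<in> space M" for \<omega>
    proof -
      interpret \<kappa>: subprob_space "\<kappa> \<omega>" by (rule subprob_\<kappa>[OF \<omega>])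
      have h_le: "norm (h y) \<le> \<bar>b\<bar>" if "y \<in> space (\<kappa> \<omega>)" for y
        using bound[of y] that sets_eq_imp_space_eq[OF sets_\<kappa>[OF \<omega>]] by simp
      have "h \<in> borel_measurable (\<kappa> \<omega>)"
        using h by (simp add: measurable_cong_sets[OF sets_\<kappa>[OF \<omega>] refl])
      hence "integrable (\<kappa> \<omega>) (\<lambda>y. norm (h y))"
        by (intro \<kappa>.integrable_const_bound[of _ "\<bar>b\<bar>"] AE_I2) (auto intro: h_le[simplified])
      hence "(\<integral>y. norm (h y) \<partial>\<kappa> \<omega>) \<le> (\<integral>y. \<bar>b\<bar> \<partial>\<kappa> \<omega>)"
        by (intro integral_mono h_le) auto
      also have "\<dots> \<le> \<bar>b\<bar>"
        using \<kappa>.subprob_measure_le_1 by (simp add: mult_left_le_one_le)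
      finally show ?thesis using integral_norm_bound[of "\<kappa> \<omega>" h] by linarith
    qed
    thus "AE \<omega> in M. norm (\<integral>y. h y \<partial>\<kappa> \<omega>) \<le> \<bar>b\<bar>" by (rule AE_I2)
  qed
  thus "integrable M (\<lambda>\<omega>. \<integral>x. h (U \<omega>, x) \<partial>K \<omega>)"
    by (simp only: Bochner_Integration.integrable_cong[OF refl inner])
qed

section \<open>Moments of the isotropic Gaussian\<close>

abbreviation std_normal :: "real measure" where
  "std_normal \<equiv> density lborel std_normal_density"

lemma prob_space_std_normal: "prob_space std_normal"
  by (rule prob_space_normal_density) simp

lemma isotropic_gaussian_measurable:
  "(\<lambda>x. \<Sum>b\<in>Basis. (\<sigma> * x b) *\<^sub>R b) \<in> measurable (\<Pi>\<^sub>M b\<in>Basis. std_normal) (borel :: 'a::euclidean_space measure)"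
  by (intro borel_measurable_sum borel_measurable_scaleR borel_measurable_times
      borel_measurable_const measurable_PiM_component_rev) auto

lemma sets_isotropic_gaussian [simp, measurable_cong]: "sets (isotropic_gaussian \<sigma>) = sets borel"
  by (simp add: isotropic_gaussian_def)

lemma space_isotropic_gaussian [simp]: "space (isotropic_gaussian \<sigma>) = UNIV"
  by (simp add: isotropic_gaussian_def)

lemma prob_space_isotropic_gaussian: "prob_space (isotropic_gaussian \<sigma>)"
  unfolding isotropic_gaussian_def
  by (intro prob_space.prob_space_distr prob_space_PiM prob_space_std_normal
      isotropic_gaussian_measurable)

lemma distr_isotropic_gaussian_coordinate:
  fixes b :: "'a::euclidean_space"
  assumes b: "b \<in> Basis"
  shows "distr (isotropic_gaussian \<sigma>) borel (\<lambda>s. inner s b) = distr std_normal borel (\<lambda>x. \<sigma> * x)"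
proof -
  let ?P = "\<Pi>\<^sub>M b\<in>(Basis :: 'a set). std_normal"
  have coord: "inner (\<Sum>c\<in>Basis. (\<sigma> * x c) *\<^sub>R c) b = \<sigma> * x b" for x
    using b by (simp add: inner_sum_left inner_Basis if_distrib cong: if_cong)
  have comp: "(\<lambda>x. x b) \<in> measurable ?P std_normal"
    by (rule measurable_component_singleton[OF b])
  have "distr (isotropic_gaussian \<sigma>) borel (\<lambda>s. inner s b) = distr ?P borel (\<lambda>x. \<sigma> * x b)"
    unfolding isotropic_gaussian_def
    by (subst distr_distr[OF _ isotropic_gaussian_measurable]) (auto simp: comp_def coord)
  also have "\<dots> = distr (distr ?P std_normal (\<lambda>x. x b)) borel (\<lambda>x. \<sigma> * x)"
    by (subst distr_distr[OF _ comp]) (auto simp: comp_def)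
  also have "distr ?P std_normal (\<lambda>x. x b) = std_normal"
    by (rule distr_PiM_component[OF prob_space_std_normal b])
  finally show ?thesis .
qed

lemma std_normal_first_moment: "has_bochner_integral std_normal (\<lambda>x. x) 0"
  using std_normal_moment_odd[of 0] by (intro has_bochner_integral_density) auto

lemma std_normal_second_moment: "has_bochner_integral std_normal (\<lambda>x. x\<^sup>2) 1"
  using std_normal_moment_even[of 1] by (intro has_bochner_integral_density) (auto simp: numeral_2_eq_2)

lemma
  fixes b :: "'a::euclidean_space"
  assumes b: "b \<in> Basis"
  shows isotropic_gaussian_coordinate_mean:
      "has_bochner_integral (isotropic_gaussian \<sigma>) (\<lambda>s. inner s b) 0"
    and isotropic_gaussian_coordinate_second_moment:
      "has_bochner_integral (isotropic_gaussian \<sigma>) (\<lambda>s. (inner s b)\<^sup>2) (\<sigma>\<^sup>2)"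
proof -
  have *: "has_bochner_integral (isotropic_gaussian \<sigma>) (\<lambda>s. f (inner s b)) c"
    if f: "f \<in> borel_measurable borel" and c: "has_bochner_integral std_normal (\<lambda>x. f (\<sigma> * x)) c"
    for f :: "real \<Rightarrow> real" and c
  proof -
    have "has_bochner_integral (distr std_normal borel (\<lambda>x. \<sigma> * x)) f c"
      using f c by (simp add: has_bochner_integral_iff integrable_distr_eq integral_distr)
    hence "has_bochner_integral (distr (isotropic_gaussian \<sigma>) borel (\<lambda>s. inner s b)) f c"
      by (simp only: distr_isotropic_gaussian_coordinate[OF b])
    thus ?thesis
      using f by (simp add: has_bochner_integral_iff integrable_distr_eq integral_distr)
  qed
  show "has_bochner_integral (isotropic_gaussian \<sigma>) (\<lambda>s. inner s b) 0"
    using has_bochner_integral_mult_right[of \<sigma>, OF std_normal_first_moment]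
    by (intro *[of "\<lambda>x. x"]) auto
  show "has_bochner_integral (isotropic_gaussian \<sigma>) (\<lambda>s. (inner s b)\<^sup>2) (\<sigma>\<^sup>2)"
    using has_bochner_integral_mult_right[of "\<sigma>\<^sup>2", OF std_normal_second_moment]
    by (intro *[of "\<lambda>x. x\<^sup>2"]) (auto simp: power_mult_distrib)
qed

lemma isotropic_gaussian_mean:
  fixes a :: "'a::euclidean_space"
  shows "has_bochner_integral (isotropic_gaussian \<sigma>) (\<lambda>s. inner a s) 0"
proof -
  have "has_bochner_integral (isotropic_gaussian \<sigma>) (\<lambda>s. \<Sum>b\<in>Basis. inner a b * inner s b)
      (\<Sum>b\<in>(Basis :: 'a set). inner a b * 0)"
    by (intro has_bochner_integral_sum has_bochner_integral_mult_right
        isotropic_gaussian_coordinate_mean)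
  moreover have "(\<Sum>b\<in>Basis. inner a b * inner s b) = inner a s" for s
    by (rule euclidean_inner[symmetric])
  ultimately show ?thesis by simp
qed

lemma isotropic_gaussian_second_moment:
  "has_bochner_integral (isotropic_gaussian \<sigma>) (\<lambda>s :: 'a::euclidean_space. (norm s)\<^sup>2)
     (real DIM('a) * \<sigma>\<^sup>2)"
proof -
  have "has_bochner_integral (isotropic_gaussian \<sigma>) (\<lambda>s :: 'a. \<Sum>b\<in>Basis. (inner s b)\<^sup>2)
      (\<Sum>b\<in>(Basis :: 'a set). \<sigma>\<^sup>2)"
    by (intro has_bochner_integral_sum isotropic_gaussian_coordinate_second_moment)
  moreover have "(norm s)\<^sup>2 = (\<Sum>b\<in>Basis. (inner s b)\<^sup>2)" for s :: 'a
    by (simp only: power2_norm_eq_inner euclidean_inner[of s s] power2_eq_square[of "inner s _"])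
  ultimately show ?thesis by simp
qed

text \<open>The bound on the first moment is nonnegativity of the variance of \<open>norm s\<close>.\<close>

lemma
  assumes "0 \<le> \<sigma>"
  shows integrable_norm_isotropic_gaussian:
      "integrable (isotropic_gaussian \<sigma>) (\<lambda>s :: 'a::euclidean_space. norm s)"
    and isotropic_gaussian_expected_norm_le:
      "(\<integral>s. norm (s :: 'a) \<partial>isotropic_gaussian \<sigma>) \<le> sqrt (real DIM('a)) * \<sigma>"
proof -
  interpret prob_space "isotropic_gaussian \<sigma> :: 'a measure" by (rule prob_space_isotropic_gaussian)
  have sq: "integrable (isotropic_gaussian \<sigma>) (\<lambda>s :: 'a. (norm s)\<^sup>2)"
    and sq_eq: "(\<integral>s. (norm (s :: 'a))\<^sup>2 \<partial>isotropic_gaussian \<sigma>) = real DIM('a) * \<sigma>\<^sup>2"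
    using isotropic_gaussian_second_moment[of \<sigma>, where 'a = 'a]
    by (auto simp: has_bochner_integral_iff)
  show int: "integrable (isotropic_gaussian \<sigma>) (\<lambda>s :: 'a. norm s)"
    by (rule square_integrable_imp_integrable[OF _ sq]) measurable
  have "0 \<le> (\<integral>s. (norm (s :: 'a))\<^sup>2 \<partial>isotropic_gaussian \<sigma>) - (\<integral>s. norm (s :: 'a) \<partial>isotropic_gaussian \<sigma>)\<^sup>2"
    using variance_positive[of "\<lambda>s :: 'a. norm s"] by (simp only: variance_eq[OF int sq])
  hence "(\<integral>s. norm (s :: 'a) \<partial>isotropic_gaussian \<sigma>)\<^sup>2 \<le> (sqrt (real DIM('a)) * \<sigma>)\<^sup>2"
    by (simp add: sq_eq power_mult_distrib)
  thus "(\<integral>s. norm (s :: 'a) \<partial>isotropic_gaussian \<sigma>) \<le> sqrt (real DIM('a)) * \<sigma>"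
    by (rule power2_le_imp_le) (use assms in simp)
qed

section \<open>The performative risk\<close>

locale performative =
  fixes S :: "'z::{real_normed_vector, second_countable_topology} set"
    and l :: "'a::euclidean_space \<Rightarrow> 'z \<Rightarrow> real" and D :: "'a \<Rightarrow> 'z measure"
    and L l_inf \<sigma>\<^sub>0 \<sigma>\<^sub>1 \<beta> l_max :: real
  assumes setting: "performative_assms S l D L l_inf \<sigma>\<^sub>0 \<sigma>\<^sub>1 \<beta> l_max"
begin

abbreviation sample_space :: "'z measure" where
  "sample_space \<equiv> restrict_space borel S"

lemma prob_D: "prob_space (D \<theta>)"
  and sets_D [simp, measurable_cong]: "sets (D \<theta>) = sets sample_space"
  and loss_measurable [measurable]: "l \<theta> \<in> borel_measurable sample_space"
  and loss_differentiable: "z \<in> S \<Longrightarrow> (\<lambda>x. l x z) differentiable (at \<theta>)"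
  and L_pos: "0 < L" and beta_nonneg: "0 \<le> \<beta>" and l_max_nonneg: "0 \<le> l_max"
  and loss_bounded: "z \<in> S \<Longrightarrow> \<bar>l \<theta> z\<bar> \<le> l_max"
  and loss_ge: "z \<in> S \<Longrightarrow> l_inf \<le> l \<theta> z"
  and tv_D: "tv_dist (D \<theta>) (D \<theta>') \<le> \<beta> * norm (\<theta> - \<theta>')"
  using setting
  by (auto simp: performative_assms_def performative_model_def smooth_loss_def
      bounded_loss_def tv_sensitive_def)

lemma loss_grad_dist:
  assumes "z \<in> S" "z' \<in> S"
  shows "norm (loss_grad l x z - loss_grad l x' z') \<le> L * (norm (x - x') + norm (z - z'))"
  using setting assms by (simp add: performative_assms_def smooth_loss_def)

lemma variance_le:
  "(\<integral>z. (norm (loss_grad l x z - risk_grad l D x \<theta>))\<^sup>2 \<partial>D \<theta>)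
     \<le> \<sigma>\<^sub>0\<^sup>2 + \<sigma>\<^sub>1\<^sup>2 * (norm (risk_grad l D x \<theta>))\<^sup>2"
  using setting by (auto simp: performative_assms_def bounded_variance_def)

lemma space_D [simp]: "space (D \<theta>) = S"
  using sets_eq_imp_space_eq[OF sets_D] by (simp add: space_restrict_space)

lemma GDERIV_loss: "z \<in> S \<Longrightarrow> GDERIV (\<lambda>x. l x z) \<theta> :> loss_grad l \<theta> z"
  unfolding loss_grad_def by (rule GDERIV_grad[OF loss_differentiable])

lemma loss_grad_lipschitz:
  "z \<in> S \<Longrightarrow> norm (loss_grad l x z - loss_grad l y z) \<le> L * norm (x - y)"
  using loss_grad_dist[of z z x y] by simp

definition grad_bound :: real where
  "grad_bound = sqrt (4 * L * l_max)"

lemma loss_grad_bounded: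
  assumes z: "z \<in> S"
  shows "norm (loss_grad l x z) \<le> grad_bound"
proof -
  have "(norm (loss_grad l x z))\<^sup>2 \<le> 4 * L * l_max"
    by (rule sq_norm_gradient_le[OF L_pos GDERIV_loss[OF z] loss_grad_lipschitz[OF z] loss_bounded[OF z]])
  thus ?thesis unfolding grad_bound_def by (rule real_le_rsqrt)
qed

text \<open>The gradient is jointly continuous on \<open>UNIV \<times> S\<close>.  As \<open>S\<close> need not be a Borel set, measurability
  goes through the trace of the Borel sets on \<open>UNIV \<times> S\<close>.\<close>

lemma loss_grad_measurable_pair [measurable]:
  "(\<lambda>(x, z). loss_grad l x z) \<in> borel_measurable (borel \<Otimes>\<^sub>M sample_space)"
proof -
  have "continuous_on (UNIV \<times> S) (\<lambda>y. loss_grad l (fst y) (snd y))"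
    unfolding continuous_on_def
  proof safe
    fix x :: 'a and z assume z: "z \<in> S"
    have lim: "((\<lambda>y. L * (norm (fst y - x) + norm (snd y - z))) \<longlongrightarrow>
        L * (norm (fst (x, z) - x) + norm (snd (x, z) - z))) (at (x, z) within UNIV \<times> S)"
      by (intro tendsto_intros tendsto_fst tendsto_snd)
    have "((\<lambda>y. loss_grad l (fst y) (snd y) - loss_grad l x z) \<longlongrightarrow> 0) (at (x, z) within UNIV \<times> S)"
      by (rule Lim_null_comparison[OF _ lim[simplified]])
         (auto simp: eventually_at_filter z intro!: always_eventually loss_grad_dist)
    thus "((\<lambda>y. loss_grad l (fst y) (snd y)) \<longlongrightarrow> loss_grad l (fst (x, z)) (snd (x, z)))
        (at (x, z) within UNIV \<times> S)"
      by (simp add: LIM_zero_iff)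
  qed
  hence "(\<lambda>y. loss_grad l (fst y) (snd y)) \<in> borel_measurable (restrict_space borel (UNIV \<times> S))"
    by (rule borel_measurable_continuous_on_restrict)
  moreover have "(\<lambda>y :: 'a \<times> 'z. y) \<in> measurable (borel \<Otimes>\<^sub>M sample_space) (restrict_space borel (UNIV \<times> S))"
  proof (rule measurable_restrict_space2)
    show "(\<lambda>y :: 'a \<times> 'z. y) \<in> space (borel \<Otimes>\<^sub>M sample_space) \<rightarrow> UNIV \<times> S"
      by (auto simp: space_pair_measure space_restrict_space)
    have "(\<lambda>y. id (snd y)) \<in> measurable (borel \<Otimes>\<^sub>M sample_space) borel"
      by (rule measurable_compose[OF measurable_snd measurable_restrict_space1[OF measurable_ident]])
    hence "(\<lambda>y :: 'a \<times> 'z. (fst y, snd y)) \<in> measurable (borel \<Otimes>\<^sub>M sample_space) (borel \<Otimes>\<^sub>M borel)"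
      by (intro measurable_Pair measurable_fst) simp
    thus "(\<lambda>y :: 'a \<times> 'z. y) \<in> measurable (borel \<Otimes>\<^sub>M sample_space) borel"
      by (simp add: borel_prod)
  qed
  ultimately have "(\<lambda>y. loss_grad l (fst y) (snd y)) \<in> borel_measurable (borel \<Otimes>\<^sub>M sample_space)"
    by (rule measurable_compose[rotated])
  thus ?thesis by (simp add: case_prod_beta')
qed

lemma loss_grad_measurable [measurable]: "loss_grad l x \<in> borel_measurable sample_space"
  using loss_grad_measurable_pair by measurable

lemma D_bounded_integrable:
  fixes g :: "'z \<Rightarrow> 'b::{banach, second_countable_topology}"
  assumes "g \<in> borel_measurable sample_space" "\<And>z. z \<in> S \<Longrightarrow> norm (g z) \<le> B"
  shows "integrable (D \<theta>) g"
proof -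
  interpret prob_space "D \<theta>" by (rule prob_D)
  show ?thesis using assms by (intro integrable_const_bound[of _ B]) (auto intro!: AE_I2)
qed

lemma integrable_loss [simp]: "integrable (D \<theta>) (l x)"
  by (rule D_bounded_integrable[of _ l_max]) (auto intro: loss_bounded)

lemma integrable_loss_grad [simp]: "integrable (D \<theta>) (loss_grad l x)"
  by (rule D_bounded_integrable[of _ grad_bound]) (auto intro: loss_grad_bounded)

lemma risk_ge: "l_inf \<le> risk l D x \<theta>"
  and risk_bounded: "\<bar>risk l D x \<theta>\<bar> \<le> l_max"
proof -
  interpret prob_space "D \<theta>" by (rule prob_D)
  show "l_inf \<le> risk l D x \<theta>"
    unfolding risk_def by (rule integral_ge_const) (auto intro!: AE_I2 loss_ge)
  have "- l_max \<le> risk l D x \<theta>"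
    unfolding risk_def
    by (rule integral_ge_const) (use loss_bounded in \<open>auto intro!: AE_I2 simp: abs_le_iff minus_le_iff\<close>)
  moreover have "risk l D x \<theta> \<le> l_max"
    unfolding risk_def
    by (rule integral_le_const) (use loss_bounded in \<open>auto intro!: AE_I2 simp: abs_le_iff\<close>)
  ultimately show "\<bar>risk l D x \<theta>\<bar> \<le> l_max" by simp
qed

lemma risk_taylor:
  "\<bar>risk l D y \<theta> - risk l D x \<theta> - inner (\<integral>z. loss_grad l x z \<partial>D \<theta>) (y - x)\<bar>
     \<le> L / 2 * (norm (y - x))\<^sup>2"
proof -
  interpret prob_space "D \<theta>" by (rule prob_D)
  define q where "q z = l y z - l x z - inner (loss_grad l x z) (y - x)" for z
  have q: "integrable (D \<theta>) q" unfolding q_def by simp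
  have eq: "risk l D y \<theta> - risk l D x \<theta> - inner (\<integral>z. loss_grad l x z \<partial>D \<theta>) (y - x) = (\<integral>z. q z \<partial>D \<theta>)"
    unfolding q_def risk_def by simp
  have bounds: "- (L / 2 * (norm (y - x))\<^sup>2) \<le> q z" "q z \<le> L / 2 * (norm (y - x))\<^sup>2" if z: "z \<in> S" for z
    using lipschitz_gradient_lower_bound[OF GDERIV_loss[OF z] loss_grad_lipschitz[OF z], of x y]
      lipschitz_gradient_upper_bound[OF GDERIV_loss[OF z] loss_grad_lipschitz[OF z], of y x]
    unfolding q_def by linarith+
  have "- (L / 2 * (norm (y - x))\<^sup>2) \<le> (\<integral>z. q z \<partial>D \<theta>)"
    using q bounds by (intro integral_ge_const) (auto intro!: AE_I2)
  moreover have "(\<integral>z. q z \<partial>D \<theta>) \<le> L / 2 * (norm (y - x))\<^sup>2"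
    using q bounds by (intro integral_le_const) (auto intro!: AE_I2)
  ultimately show ?thesis unfolding eq by (simp add: abs_le_iff)
qed

lemma risk_grad_eq: "risk_grad l D x \<theta> = (\<integral>z. loss_grad l x z \<partial>D \<theta>)"
  unfolding risk_grad_def
  by (rule grad_eqI, rule GDERIV_of_quadratic_remainder, rule risk_taylor)

lemma risk_upper_bound:
  "risk l D y \<theta> \<le> risk l D x \<theta> + inner (risk_grad l D x \<theta>) (y - x) + L / 2 * (norm (y - x))\<^sup>2"
  using risk_taylor[of y \<theta> x] unfolding risk_grad_eq by linarith

lemma risk_grad_lipschitz: "norm (risk_grad l D x \<theta> - risk_grad l D y \<theta>) \<le> L * norm (x - y)"
proof -
  interpret prob_space "D \<theta>" by (rule prob_D)
  have "risk_grad l D x \<theta> - risk_grad l D y \<theta> = (\<integral>z. loss_grad l x z - loss_grad l y z \<partial>D \<theta>)"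
    by (simp add: risk_grad_eq)
  also have "norm \<dots> \<le> (\<integral>z. norm (loss_grad l x z - loss_grad l y z) \<partial>D \<theta>)"
    by (rule integral_norm_bound)
  also have "\<dots> \<le> L * norm (x - y)"
    by (rule integral_le_const) (auto intro!: AE_I2 loss_grad_lipschitz)
  finally show ?thesis .
qed

lemma risk_grad_bounded: "norm (risk_grad l D x \<theta>) \<le> grad_bound"
proof -
  interpret prob_space "D \<theta>" by (rule prob_D)
  have "norm (risk_grad l D x \<theta>) \<le> (\<integral>z. norm (loss_grad l x z) \<partial>D \<theta>)"
    unfolding risk_grad_eq by (rule integral_norm_bound)
  also have "\<dots> \<le> grad_bound"
    by (rule integral_le_const) (auto intro!: AE_I2 loss_grad_bounded)
  finally show ?thesis .
qed

text \<open>The second moment is the variance plus the squared norm of the mean.\<close>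

lemma second_moment_loss_grad_le:
  "(\<integral>z. (norm (loss_grad l x z))\<^sup>2 \<partial>D \<theta>) \<le> \<sigma>\<^sub>0\<^sup>2 + (1 + \<sigma>\<^sub>1\<^sup>2) * (norm (risk_grad l D x \<theta>))\<^sup>2"
proof -
  interpret prob_space "D \<theta>" by (rule prob_D)
  define r where "r = risk_grad l D x \<theta>"
  have sq: "integrable (D \<theta>) (\<lambda>z. (norm (loss_grad l x z))\<^sup>2)"
    by (rule D_bounded_integrable[of _ "grad_bound\<^sup>2"]) (auto intro!: power_mono loss_grad_bounded)
  have "(\<integral>z. (norm (loss_grad l x z - r))\<^sup>2 \<partial>D \<theta>)
      = (\<integral>z. (norm (loss_grad l x z))\<^sup>2 - 2 * inner (loss_grad l x z) r + (norm r)\<^sup>2 \<partial>D \<theta>)"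
    by (intro Bochner_Integration.integral_cong)
       (auto simp: power2_norm_eq_inner inner_diff_left inner_diff_right inner_commute)
  also have "\<dots> = (\<integral>z. (norm (loss_grad l x z))\<^sup>2 \<partial>D \<theta>) - 2 * inner r r + (norm r)\<^sup>2"
    using sq by (simp add: r_def risk_grad_eq prob_space[simplified])
  finally show ?thesis
    using variance_le[where x = x and \<theta> = \<theta>] unfolding r_def[symmetric]
    by (simp add: power2_norm_eq_inner[of r] algebra_simps)
qed

text \<open>The loss takes values in an interval of length \<open>2 * l_max\<close>; this is the cost of a change of the
  deployed distribution.\<close>

lemma risk_shift: "risk l D x \<theta> - risk l D x \<theta>' \<le> 2 * l_max * \<beta> * norm (\<theta> - \<theta>')"
proof -
  have "risk l D x \<theta> - risk l D x \<theta>' \<le> (l_max - (- l_max)) * tv_dist (D \<theta>) (D \<theta>')"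
    unfolding risk_def
  proof (rule expectation_diff_le_tv_dist[OF prob_D prob_D])
    show "- l_max \<le> l x z \<and> l x z \<le> l_max" if "z \<in> space (D \<theta>)" for z
      using loss_bounded[of z x] that by (auto simp: abs_le_iff)
  qed (use l_max_nonneg in auto)
  also have "\<dots> \<le> (l_max - (- l_max)) * (\<beta> * norm (\<theta> - \<theta>'))"
    using tv_D l_max_nonneg by (intro mult_left_mono) auto
  finally show ?thesis by (simp add: mult.assoc)
qed

text \<open>The risk is jointly continuous: the gradient bound controls the change of the evaluation point
  and the total variation bound that of the distribution.\<close>

lemma risk_measurable_pair [measurable]:
  "(\<lambda>(x, \<theta>). risk l D x \<theta>) \<in> borel_measurable (borel \<Otimes>\<^sub>M borel)"
proof -
  have "continuous_on UNIV (\<lambda>y. risk l D (fst y) (snd y))"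
    unfolding continuous_on_def
  proof safe
    fix x \<theta> :: 'a
    let ?b = "\<lambda>y. grad_bound * norm (fst y - x) + L / 2 * (norm (fst y - x))\<^sup>2
      + 2 * l_max * \<beta> * norm (snd y - \<theta>)"
    have lim: "(?b \<longlongrightarrow> ?b (x, \<theta>)) (at (x, \<theta>))"
      by (intro tendsto_intros tendsto_fst tendsto_snd)
    have "norm (risk l D (fst y) (snd y) - risk l D x \<theta>) \<le> ?b y" for y
    proof -
      have "\<bar>inner (risk_grad l D x \<theta>) (fst y - x)\<bar> \<le> norm (risk_grad l D x \<theta>) * norm (fst y - x)"
        by (rule Cauchy_Schwarz_ineq2)
      also have "\<dots> \<le> grad_bound * norm (fst y - x)"
        by (intro mult_right_mono risk_grad_bounded) auto
      finally have "\<bar>inner (risk_grad l D x \<theta>) (fst y - x)\<bar> \<le> grad_bound * norm (fst y - x)" .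
      thus ?thesis
        using risk_taylor[of "fst y" \<theta> x] risk_shift[of "fst y" "snd y" \<theta>]
          risk_shift[of "fst y" \<theta> "snd y"]
        unfolding risk_grad_eq[symmetric] real_norm_def norm_minus_commute[of \<theta> "snd y"] by linarith
    qed
    hence "((\<lambda>y. risk l D (fst y) (snd y) - risk l D x \<theta>) \<longlongrightarrow> 0) (at (x, \<theta>))"
      by (intro Lim_null_comparison[OF _ lim[simplified]] always_eventually) auto
    thus "((\<lambda>y. risk l D (fst y) (snd y)) \<longlongrightarrow> risk l D (fst (x, \<theta>)) (snd (x, \<theta>))) (at (x, \<theta>))"
      by (simp add: LIM_zero_iff)
  qed
  thus ?thesis unfolding borel_prod case_prod_beta' by (rule borel_measurable_continuous_onI)
qed

text \<open>Sensitivity in total variation makes the probability of each event Lipschitz in the deployed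
  parameter; hence \<open>D\<close> is a Markov kernel.\<close>

lemma D_measurable [measurable]: "D \<in> measurable borel (subprob_algebra sample_space)"
proof (rule measurable_subprob_algebra)
  fix A assume A: "A \<in> sets sample_space"
  have "continuous_on UNIV (\<lambda>\<theta>. measure (D \<theta>) A)"
    unfolding continuous_on_def
  proof safe
    fix \<theta> :: 'a
    have lim: "((\<lambda>\<theta>'. \<beta> * norm (\<theta>' - \<theta>)) \<longlongrightarrow> \<beta> * norm (\<theta> - \<theta>)) (at \<theta>)"
      by (intro tendsto_intros)
    have "norm (measure (D \<theta>') A - measure (D \<theta>) A) \<le> \<beta> * norm (\<theta>' - \<theta>)" for \<theta>'
      using tv_dist_ge[OF prob_D[of \<theta>'] prob_D[of \<theta>], of A] tv_D[of \<theta>' \<theta>] A by simp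
    hence "((\<lambda>\<theta>'. measure (D \<theta>') A - measure (D \<theta>) A) \<longlongrightarrow> 0) (at \<theta>)"
      by (intro Lim_null_comparison[OF _ lim[simplified]] always_eventually) auto
    thus "((\<lambda>\<theta>'. measure (D \<theta>') A) \<longlongrightarrow> measure (D \<theta>) A) (at \<theta>)"
      by (simp add: LIM_zero_iff)
  qed
  hence "(\<lambda>\<theta>. measure (D \<theta>) A) \<in> borel_measurable borel"
    by (rule borel_measurable_continuous_onI)
  moreover have "emeasure (D \<theta>) A = ennreal (measure (D \<theta>) A)" for \<theta>
  proof -
    interpret prob_space "D \<theta>" by (rule prob_D)
    show ?thesis by (rule emeasure_eq_measure)
  qed
  ultimately show "(\<lambda>\<theta>. emeasure (D \<theta>) A) \<in> borel_measurable borel" by simp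
qed (auto intro: prob_space_imp_subprob_space prob_D)

lemma risk_grad_diagonal_measurable [measurable]:
  "(\<lambda>\<theta>. risk_grad l D \<theta> \<theta>) \<in> borel_measurable borel"
proof -
  have "(\<lambda>\<theta>. distr (D \<theta>) (borel \<Otimes>\<^sub>M sample_space) (\<lambda>z. (\<theta>, z)))
      \<in> measurable borel (subprob_algebra (borel \<Otimes>\<^sub>M sample_space))"
    by (rule measurable_distr2[OF _ D_measurable]) measurable
  hence "(\<lambda>\<theta>. \<integral>y. (case y of (x, z) \<Rightarrow> loss_grad l x z)
      \<partial>distr (D \<theta>) (borel \<Otimes>\<^sub>M sample_space) (\<lambda>z. (\<theta>, z))) \<in> borel_measurable borel"
    by (rule measurable_compose[OF _ integral_measurable_subprob_algebra[OF loss_grad_measurable_pair]])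
  thus ?thesis
    by (subst (asm) integral_distr) (auto simp: risk_grad_eq[abs_def])
qed

section \<open>Drift of the potential in one step\<close>

definition dice_step :: "real \<Rightarrow> real \<Rightarrow> real \<Rightarrow> 'a \<times> 'a \<Rightarrow> 'z \<times> 'a \<Rightarrow> 'a \<times> 'a" where
  "dice_step \<gamma> C\<^sub>1 C\<^sub>2 u y =
     (let g = loss_grad l (fst u) (fst y); v = clip C\<^sub>1 g + clip C\<^sub>2 (snd u)
      in (fst u - \<gamma> *\<^sub>R (v + snd y), snd u + g - v))"

text \<open>The risk at the error-corrected iterate \<open>\<theta> - \<gamma> e\<close>, under the distribution that \<open>\<theta>\<close> deploys.\<close>

definition potential :: "real \<Rightarrow> 'a \<times> 'a \<Rightarrow> real" where
  "potential \<gamma> u = risk l D (fst u - \<gamma> *\<^sub>R snd u) (fst u)"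

lemma potential_bounded: "\<bar>potential \<gamma> u\<bar> \<le> l_max"
  unfolding potential_def by (rule risk_bounded)

lemma potential_measurable [measurable]: "potential \<gamma> \<in> borel_measurable (borel \<Otimes>\<^sub>M borel)"
proof -
  have "(\<lambda>u :: 'a \<times> 'a. (fst u - \<gamma> *\<^sub>R snd u, fst u))
      \<in> measurable (borel \<Otimes>\<^sub>M borel) (borel \<Otimes>\<^sub>M borel)"
    by measurable
  from measurable_compose[OF this risk_measurable_pair] show ?thesis
    by (simp add: potential_def[abs_def])
qed

lemma dice_step_measurable [measurable]:
  "(\<lambda>y. dice_step \<gamma> C\<^sub>1 C\<^sub>2 (fst y) (snd y))
     \<in> measurable ((borel \<Otimes>\<^sub>M borel) \<Otimes>\<^sub>M (sample_space \<Otimes>\<^sub>M borel)) (borel \<Otimes>\<^sub>M borel)"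
proof -
  have "(\<lambda>y. (fst (fst y), fst (snd y)))
      \<in> measurable (((borel :: 'a measure) \<Otimes>\<^sub>M (borel :: 'a measure)) \<Otimes>\<^sub>M
          (sample_space \<Otimes>\<^sub>M (borel :: 'a measure))) (borel \<Otimes>\<^sub>M sample_space)"
    by measurable
  from measurable_compose[OF this loss_grad_measurable_pair]
  have [measurable]: "(\<lambda>y. loss_grad l (fst (fst y)) (fst (snd y))) \<in> borel_measurable
      (((borel :: 'a measure) \<Otimes>\<^sub>M (borel :: 'a measure)) \<Otimes>\<^sub>M (sample_space \<Otimes>\<^sub>M (borel :: 'a measure)))"
    by simp
  show ?thesis unfolding dice_step_def Let_def by measurable
qed

lemma potential_dice_step_measurable:
  "(\<lambda>y. potential \<gamma> (dice_step \<gamma> C\<^sub>1 C\<^sub>2 (fst y) (snd y)))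
     \<in> borel_measurable ((borel \<Otimes>\<^sub>M borel) \<Otimes>\<^sub>M (sample_space \<Otimes>\<^sub>M borel))"
  by (rule measurable_compose[OF dice_step_measurable potential_measurable])

text \<open>Clipping cancels in the error-corrected iterate \<open>x = \<theta> - \<gamma> e\<close>, which moves by exactly
  \<open>- \<gamma> (g + s)\<close>, so the descent lemma applies to it with the unclipped gradient.  The clipped step
  only matters for the displacement of the deployed parameter \<open>\<theta>\<close>, which clipping bounds by
  \<open>\<gamma> (C\<^sub>1 + C\<^sub>2 + norm s)\<close>.\<close>

lemma potential_dice_step_le:
  fixes \<theta> e :: 'a
  assumes "0 \<le> \<gamma>" "0 \<le> C\<^sub>1" "0 \<le> C\<^sub>2"
  defines "x \<equiv> \<theta> - \<gamma> *\<^sub>R e"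
  shows "potential \<gamma> (dice_step \<gamma> C\<^sub>1 C\<^sub>2 (\<theta>, e) (z, s)) \<le>
    potential \<gamma> (\<theta>, e) - \<gamma> * inner (risk_grad l D x \<theta>) (loss_grad l \<theta> z + s)
      + L / 2 * \<gamma>\<^sup>2 * (norm (loss_grad l \<theta> z + s))\<^sup>2
      + 2 * l_max * \<beta> * \<gamma> * (C\<^sub>1 + C\<^sub>2 + norm s)"
proof -
  define g where "g = loss_grad l \<theta> z"
  define v where "v = clip C\<^sub>1 g + clip C\<^sub>2 e"
  define \<theta>' where "\<theta>' = \<theta> - \<gamma> *\<^sub>R (v + s)"
  define x' where "x' = x - \<gamma> *\<^sub>R (g + s)"
  have "\<theta>' - \<gamma> *\<^sub>R (e + g - v) = x'"
    by (simp add: \<theta>'_def x'_def x_def algebra_simps)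
  hence pot: "potential \<gamma> (dice_step \<gamma> C\<^sub>1 C\<^sub>2 (\<theta>, e) (z, s)) = risk l D x' \<theta>'"
    by (simp add: potential_def dice_step_def Let_def g_def[symmetric] v_def[symmetric] \<theta>'_def[symmetric])
  have "norm (v + s) \<le> C\<^sub>1 + C\<^sub>2 + norm s"
    using norm_triangle_ineq[of v s] norm_triangle_ineq[of "clip C\<^sub>1 g" "clip C\<^sub>2 e"]
      norm_clip_le[OF assms(2), of g] norm_clip_le[OF assms(3), of e] unfolding v_def by linarith
  hence "2 * l_max * \<beta> * norm (\<theta>' - \<theta>) \<le> 2 * l_max * \<beta> * (\<gamma> * (C\<^sub>1 + C\<^sub>2 + norm s))"
    unfolding \<theta>'_def using assms(1) l_max_nonneg beta_nonneg
    by (intro mult_left_mono) (auto intro!: mult_left_mono)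
  hence "risk l D x' \<theta>' \<le> risk l D x' \<theta> + 2 * l_max * \<beta> * \<gamma> * (C\<^sub>1 + C\<^sub>2 + norm s)"
    using risk_shift[of x' \<theta>' \<theta>] by (simp add: mult.assoc)
  also have "risk l D x' \<theta> \<le> risk l D x \<theta> - \<gamma> * inner (risk_grad l D x \<theta>) (g + s)
      + L / 2 * \<gamma>\<^sup>2 * (norm (g + s))\<^sup>2"
    using risk_upper_bound[of x' \<theta> x] assms(1) by (simp add: x'_def power_mult_distrib)
  finally show ?thesis
    unfolding pot by (simp add: potential_def x_def g_def)
qed

text \<open>The mean gradient is taken at \<open>\<theta>\<close> but the potential decreases along the gradient at \<open>x\<close>.
  Weighting Young's inequality so that only a quarter of the squared gradient is lost leaves
  enough to absorb the second-moment term of the descent lemma and still keep one half.  The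
  symmetric choice keeps one quarter in the end, which would double the bias.\<close>

lemma inner_shifted_gradient_ge:
  "3 / 4 * (norm (risk_grad l D \<theta> \<theta>'))\<^sup>2 - L\<^sup>2 * (norm (x - \<theta>))\<^sup>2
     \<le> inner (risk_grad l D x \<theta>') (risk_grad l D \<theta> \<theta>')"
proof -
  define r where "r = risk_grad l D \<theta> \<theta>'"
  define d where "d = risk_grad l D x \<theta>' - r"
  have "(norm d)\<^sup>2 \<le> (L * norm (x - \<theta>))\<^sup>2"
    unfolding d_def r_def by (intro power_mono risk_grad_lipschitz) simp
  moreover have "0 \<le> (norm (d + (1 / 2) *\<^sub>R r))\<^sup>2" by simp
  hence "0 \<le> (norm d)\<^sup>2 + inner d r + (norm r)\<^sup>2 / 4"
    by (simp add: power2_norm_eq_inner inner_add_left inner_add_right inner_commute)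
  moreover have "inner (risk_grad l D x \<theta>') r = (norm r)\<^sup>2 + inner d r"
    by (simp add: d_def power2_norm_eq_inner inner_diff_left)
  ultimately show ?thesis
    unfolding r_def[symmetric] by (simp add: power_mult_distrib)
qed

text \<open>Averaging over the noise removes the linear terms in \<open>s\<close>; averaging over the sample replaces the
  stochastic gradient by the gradient of the risk.  Of the coefficient \<open>\<gamma>\<close> of the squared gradient,
  \<open>\<gamma> / 4\<close> is lost to the mismatch between \<open>\<theta>\<close> and \<open>\<theta> - \<gamma> e\<close>, and at most \<open>\<gamma> / 4\<close> to the second
  moment of the stochastic gradient, by the condition on the step size.\<close>

lemma expected_potential_dice_step_le:
  assumes \<gamma>: "0 < \<gamma>" and C: "0 \<le> C\<^sub>1" "0 \<le> C\<^sub>2" and \<sigma>: "0 \<le> \<sigma>"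
    and step_size: "L * \<gamma> * (1 + \<sigma>\<^sub>1\<^sup>2) \<le> 1 / 2"
  shows "(\<integral>y. potential \<gamma> (dice_step \<gamma> C\<^sub>1 C\<^sub>2 (\<theta>, e) y) \<partial>(D \<theta> \<Otimes>\<^sub>M isotropic_gaussian \<sigma>))
    \<le> potential \<gamma> (\<theta>, e) - \<gamma> / 2 * (norm (risk_grad l D \<theta> \<theta>))\<^sup>2 + L\<^sup>2 * \<gamma> ^ 3 * (norm e)\<^sup>2
      + (L / 2 * \<gamma>\<^sup>2 * (real DIM('a) * \<sigma>\<^sup>2 + \<sigma>\<^sub>0\<^sup>2)
         + 2 * l_max * \<beta> * \<gamma> * (C\<^sub>1 + C\<^sub>2 + sqrt (real DIM('a)) * \<sigma>))"
proof -
  let ?N = "isotropic_gaussian \<sigma> :: 'a measure"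
  interpret Dp: prob_space "D \<theta>" by (rule prob_D)
  interpret Np: prob_space ?N by (rule prob_space_isotropic_gaussian)
  interpret pair_prob_space "D \<theta>" ?N ..
  define x where "x = \<theta> - \<gamma> *\<^sub>R e"
  define p where "p = risk_grad l D x \<theta>"
  define r where "r = risk_grad l D \<theta> \<theta>"
  define f where "f y = potential \<gamma> (dice_step \<gamma> C\<^sub>1 C\<^sub>2 (\<theta>, e) y)" for y
  define bias where "bias = 2 * l_max * \<beta> * \<gamma> * (C\<^sub>1 + C\<^sub>2 + sqrt (real DIM('a)) * \<sigma>)"
  define d where "d = real DIM('a) * \<sigma>\<^sup>2"
  define b where "b z = potential \<gamma> (\<theta>, e) - \<gamma> * inner (loss_grad l \<theta> z) p
      + L / 2 * \<gamma>\<^sup>2 * ((norm (loss_grad l \<theta> z))\<^sup>2 + d) + bias" for z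
  have f_meas: "f \<in> borel_measurable (D \<theta> \<Otimes>\<^sub>M ?N)"
  proof -
    have "(\<lambda>y. ((\<theta>, e), y)) \<in> measurable (sample_space \<Otimes>\<^sub>M borel)
        ((borel \<Otimes>\<^sub>M borel) \<Otimes>\<^sub>M (sample_space \<Otimes>\<^sub>M (borel :: 'a measure)))"
      by (rule measurable_Pair1') (simp add: space_pair_measure)
    from measurable_compose[OF this potential_dice_step_measurable]
    have "f \<in> borel_measurable (sample_space \<Otimes>\<^sub>M (borel :: 'a measure))"
      by (simp add: f_def[abs_def])
    thus ?thesis
      by (simp add: measurable_cong_sets[OF sets_pair_measure_cong[OF sets_D sets_isotropic_gaussian] refl])
  qed
  have f_int: "integrable (D \<theta> \<Otimes>\<^sub>M ?N) f"
    using f_meas potential_bounded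
    by (intro P.integrable_const_bound[of _ l_max]) (auto simp: f_def intro!: AE_I2)
  have inner_le: "(\<integral>s. f (z, s) \<partial>?N) \<le> b z" if z: "z \<in> S" for z
  proof -
    define g where "g = loss_grad l \<theta> z"
    have "(\<lambda>s. f (z, s)) \<in> borel_measurable ?N"
      by (rule measurable_compose[OF measurable_Pair1' f_meas]) (simp add: z)
    hence int_f: "integrable ?N (\<lambda>s. f (z, s))"
      using potential_bounded
      by (intro Np.integrable_const_bound[of _ l_max]) (auto simp: f_def intro!: AE_I2)
    note norm_int = integrable_norm_isotropic_gaussian[OF \<sigma>, where 'a = 'a]
    have lin: "integrable ?N (\<lambda>s. inner a s)" "(\<integral>s. inner a s \<partial>?N) = 0" for a :: 'a
      using isotropic_gaussian_mean[of \<sigma> a] by (auto simp: has_bochner_integral_iff)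
    have sq: "integrable ?N (\<lambda>s. (norm s)\<^sup>2)" "(\<integral>s. (norm (s :: 'a))\<^sup>2 \<partial>?N) = d"
      using isotropic_gaussian_second_moment[of \<sigma>, where 'a = 'a]
      by (auto simp: has_bochner_integral_iff d_def)
    \<comment> \<open>The bound of \<open>potential_dice_step_le\<close>, ordered by its dependence on \<open>s\<close>.\<close>
    define q where "q s = (potential \<gamma> (\<theta>, e) - \<gamma> * inner p g + L / 2 * \<gamma>\<^sup>2 * (norm g)\<^sup>2
          + 2 * l_max * \<beta> * \<gamma> * (C\<^sub>1 + C\<^sub>2))
        + (- \<gamma>) * inner p s + L * \<gamma>\<^sup>2 * inner g s + L / 2 * \<gamma>\<^sup>2 * (norm s)\<^sup>2
        + 2 * l_max * \<beta> * \<gamma> * norm s" for s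
    have q_eq: "f (z, s) \<le> q s" for s
    proof -
      have "(norm (g + s))\<^sup>2 = (norm g)\<^sup>2 + 2 * inner g s + (norm s)\<^sup>2"
        by (simp add: power2_norm_eq_inner inner_add_left inner_add_right inner_commute)
      thus ?thesis
        using potential_dice_step_le[of \<gamma> C\<^sub>1 C\<^sub>2 \<theta> e z s] \<gamma> C
        unfolding f_def q_def x_def[symmetric] p_def[symmetric] g_def[symmetric]
        by (simp add: inner_add_right algebra_simps)
    qed
    have q_int: "integrable ?N q" unfolding q_def using norm_int lin(1) sq(1) by simp
    have "(\<integral>s. f (z, s) \<partial>?N) \<le> (\<integral>s. q s \<partial>?N)"
      by (rule integral_mono[OF int_f q_int q_eq])
    also have "\<dots> = (potential \<gamma> (\<theta>, e) - \<gamma> * inner p g + L / 2 * \<gamma>\<^sup>2 * (norm g)\<^sup>2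
          + 2 * l_max * \<beta> * \<gamma> * (C\<^sub>1 + C\<^sub>2))
        + L / 2 * \<gamma>\<^sup>2 * d + 2 * l_max * \<beta> * \<gamma> * (\<integral>s. norm (s :: 'a) \<partial>?N)"
      unfolding q_def using norm_int lin sq Np.prob_space by simp
    also have "2 * l_max * \<beta> * \<gamma> * (\<integral>s. norm (s :: 'a) \<partial>?N)
        \<le> 2 * l_max * \<beta> * \<gamma> * (sqrt (real DIM('a)) * \<sigma>)"
      using isotropic_gaussian_expected_norm_le[OF \<sigma>, where 'a = 'a] l_max_nonneg beta_nonneg \<gamma>
      by (intro mult_left_mono) auto
    finally show ?thesis
      unfolding b_def bias_def g_def[symmetric] by (simp add: inner_commute algebra_simps add_divide_distrib)
  qed
  have sq_g: "integrable (D \<theta>) (\<lambda>z. (norm (loss_grad l \<theta> z))\<^sup>2)"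
    by (rule D_bounded_integrable[of _ "grad_bound\<^sup>2"]) (auto intro!: power_mono loss_grad_bounded)
  have b_int: "integrable (D \<theta>) b" unfolding b_def using sq_g by simp
  have "(\<integral>y. f y \<partial>(D \<theta> \<Otimes>\<^sub>M ?N)) = (\<integral>z. (\<integral>s. f (z, s) \<partial>?N) \<partial>D \<theta>)"
    by (rule integral_fst'[OF f_int, symmetric])
  also have "\<dots> \<le> (\<integral>z. b z \<partial>D \<theta>)"
    using inner_le by (intro integral_mono integrable_fst'[OF f_int] b_int) simp
  also have "\<dots> = potential \<gamma> (\<theta>, e) - \<gamma> * inner r p
      + L / 2 * \<gamma>\<^sup>2 * ((\<integral>z. (norm (loss_grad l \<theta> z))\<^sup>2 \<partial>D \<theta>) + d) + bias"
    unfolding b_def r_def risk_grad_eq using sq_g Dp.prob_space[simplified] by simp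
  also have "\<dots> \<le> potential \<gamma> (\<theta>, e) - \<gamma> / 2 * (norm r)\<^sup>2 + L\<^sup>2 * \<gamma> ^ 3 * (norm e)\<^sup>2
      + (L / 2 * \<gamma>\<^sup>2 * (d + \<sigma>\<^sub>0\<^sup>2) + bias)"
  proof -
    have "\<gamma> * (3 / 4 * (norm r)\<^sup>2 - L\<^sup>2 * (norm (x - \<theta>))\<^sup>2) \<le> \<gamma> * inner p r"
      using inner_shifted_gradient_ge[of \<theta> \<theta> x] \<gamma> unfolding p_def r_def
      by (intro mult_left_mono) auto
    hence 1: "\<gamma> * (3 / 4) * (norm r)\<^sup>2 - L\<^sup>2 * \<gamma> ^ 3 * (norm e)\<^sup>2 \<le> \<gamma> * inner r p"
      using \<gamma> by (simp add: x_def inner_commute power_mult_distrib power2_eq_square power3_eq_cube algebra_simps)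
    have "L / 2 * \<gamma>\<^sup>2 * (\<integral>z. (norm (loss_grad l \<theta> z))\<^sup>2 \<partial>D \<theta>)
        \<le> L / 2 * \<gamma>\<^sup>2 * (\<sigma>\<^sub>0\<^sup>2 + (1 + \<sigma>\<^sub>1\<^sup>2) * (norm r)\<^sup>2)"
      using L_pos unfolding r_def by (intro mult_left_mono second_moment_loss_grad_le) auto
    also have "\<dots> = L / 2 * \<gamma>\<^sup>2 * \<sigma>\<^sub>0\<^sup>2 + (L * \<gamma> * (1 + \<sigma>\<^sub>1\<^sup>2)) * (\<gamma> / 2 * (norm r)\<^sup>2)"
      by (simp add: power2_eq_square[of \<gamma>] algebra_simps)
    also have "(L * \<gamma> * (1 + \<sigma>\<^sub>1\<^sup>2)) * (\<gamma> / 2 * (norm r)\<^sup>2) \<le> 1 / 2 * (\<gamma> / 2 * (norm r)\<^sup>2)"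
      using step_size \<gamma> by (intro mult_right_mono) auto
    finally have 2: "L / 2 * \<gamma>\<^sup>2 * (\<integral>z. (norm (loss_grad l \<theta> z))\<^sup>2 \<partial>D \<theta>)
        \<le> L / 2 * \<gamma>\<^sup>2 * \<sigma>\<^sub>0\<^sup>2 + \<gamma> / 4 * (norm r)\<^sup>2" by simp
    have 3: "L / 2 * \<gamma>\<^sup>2 * (I + J) = L / 2 * \<gamma>\<^sup>2 * I + L / 2 * \<gamma>\<^sup>2 * J" for I J
      by (rule distrib_left)
    show ?thesis using 1 2 unfolding 3 by linarith
  qed
  finally show ?thesis
    unfolding f_def r_def d_def bias_def .
qed

end

section \<open>Convergence of the algorithm\<close>

locale dice_run = performative S l D L l_inf \<sigma>\<^sub>0 \<sigma>\<^sub>1 \<beta> l_max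
  for S :: "'z::{real_normed_vector, second_countable_topology} set"
    and l :: "'a::euclidean_space \<Rightarrow> 'z \<Rightarrow> real" and D :: "'a \<Rightarrow> 'z measure"
    and L l_inf \<sigma>\<^sub>0 \<sigma>\<^sub>1 \<beta> l_max :: real +
  fixes \<Omega> :: "'w measure" and F :: "nat \<Rightarrow> 'w measure" and \<gamma> C\<^sub>1 C\<^sub>2 \<sigma> M :: real and T :: nat
    and \<theta> e \<zeta> :: "nat \<Rightarrow> 'w \<Rightarrow> 'a" and Z :: "nat \<Rightarrow> 'w \<Rightarrow> 'z"
  assumes run: "dice_sgd \<Omega> F S l D \<gamma> C\<^sub>1 C\<^sub>2 \<sigma> T \<theta> e Z \<zeta>"
    and error: "bounded_error \<Omega> e T M"
begin

definition state :: "nat \<Rightarrow> 'w \<Rightarrow> 'a \<times> 'a" where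
  "state t \<omega> = (\<theta> t \<omega>, e t \<omega>)"

lemma gamma_pos: "0 < \<gamma>" and C1_nonneg: "0 \<le> C\<^sub>1" and C2_nonneg: "0 \<le> C\<^sub>2" and sigma_nonneg: "0 \<le> \<sigma>"
  and prob_\<Omega>: "prob_space \<Omega>" and filtration_F: "filtration (space \<Omega>) F"
  and subalgebra_F: "subalgebra \<Omega> (F t)"
  and sample_measurable: "t < T \<Longrightarrow> Z (Suc t) \<in> measurable (F (Suc t)) sample_space"
  and noise_measurable: "t < T \<Longrightarrow> \<zeta> (Suc t) \<in> borel_measurable (F (Suc t))"
  and draw_law: "t < T \<Longrightarrow> A \<in> sets sample_space \<Longrightarrow> B \<in> sets borel \<Longrightarrow> AE \<omega> in \<Omega>.
      real_cond_exp \<Omega> (F t) (\<lambda>\<omega>'. indicator A (Z (Suc t) \<omega>') * indicator B (\<zeta> (Suc t) \<omega>')) \<omega>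
        = measure (D (\<theta> t \<omega>)) A * measure (isotropic_gaussian \<sigma>) B"
  using run by (auto simp: dice_sgd_def)

lemma state_Suc:
  assumes "t < T" "\<omega> \<in> space \<Omega>"
  shows "state (Suc t) \<omega> = dice_step \<gamma> C\<^sub>1 C\<^sub>2 (state t \<omega>) (Z (Suc t) \<omega>, \<zeta> (Suc t) \<omega>)"
  using run assms by (simp add: dice_sgd_def state_def dice_step_def Let_def)

lemma initial_error: "\<omega> \<in> space \<Omega> \<Longrightarrow> e 0 \<omega> = 0"
  using run by (simp add: dice_sgd_def)

sublocale prob_space \<Omega> by (rule prob_\<Omega>)

lemma space_F: "space (F t) = space \<Omega>"
  using subalgebra_F by (simp add: subalgebra_def)

lemma state_adapted: "t \<le> T \<Longrightarrow> state t \<in> measurable (F t) (borel \<Otimes>\<^sub>M borel)"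
proof (induction t)
  case 0
  have "e 0 \<in> borel_measurable (F 0)"
    using initial_error by (subst measurable_cong[where g = "\<lambda>_. 0"]) (auto simp: space_F)
  moreover have "\<theta> 0 \<in> borel_measurable (F 0)" using run by (simp add: dice_sgd_def)
  ultimately show ?case by (simp add: state_def[abs_def])
next
  case (Suc t)
  interpret filtration "space \<Omega>" F by (rule filtration_F)
  have sub: "subalgebra (F (Suc t)) (F t)"
    using sets_F_mono[of t "Suc t"] by (simp add: subalgebra_def space_F)
  have "state t \<in> measurable (F (Suc t)) (borel \<Otimes>\<^sub>M borel)"
    by (rule measurable_from_subalg[OF sub Suc.IH]) (use Suc.prems in simp)
  moreover have "(\<lambda>\<omega>. (Z (Suc t) \<omega>, \<zeta> (Suc t) \<omega>)) \<in> measurable (F (Suc t)) (sample_space \<Otimes>\<^sub>M borel)"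
    using Suc.prems by (intro measurable_Pair sample_measurable noise_measurable) auto
  ultimately have "(\<lambda>\<omega>. (state t \<omega>, (Z (Suc t) \<omega>, \<zeta> (Suc t) \<omega>)))
      \<in> measurable (F (Suc t)) ((borel \<Otimes>\<^sub>M borel) \<Otimes>\<^sub>M (sample_space \<Otimes>\<^sub>M borel))"
    by (rule measurable_Pair)
  from measurable_compose[OF this dice_step_measurable[of \<gamma> C\<^sub>1 C\<^sub>2]]
  show ?case
    by (subst measurable_cong[OF state_Suc]) (use Suc.prems in \<open>auto simp: space_F\<close>)
qed

lemma state_measurable: "t \<le> T \<Longrightarrow> state t \<in> measurable \<Omega> (borel \<Otimes>\<^sub>M borel)"
  by (rule measurable_from_subalg[OF subalgebra_F state_adapted])

lemma theta_adapted: "t \<le> T \<Longrightarrow> \<theta> t \<in> borel_measurable (F t)"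
  using measurable_compose[OF state_adapted measurable_fst] by (simp add: state_def)

definition kernel :: "nat \<Rightarrow> 'w \<Rightarrow> ('z \<times> 'a) measure" where
  "kernel t \<omega> = D (\<theta> t \<omega>) \<Otimes>\<^sub>M isotropic_gaussian \<sigma>"

lemma kernel_measurable:
  assumes "t \<le> T"
  shows "kernel t \<in> measurable (F t) (subprob_algebra (sample_space \<Otimes>\<^sub>M borel))"
  unfolding kernel_def[abs_def]
proof (rule measurable_pair_measure)
  show "(\<lambda>\<omega>. D (\<theta> t \<omega>)) \<in> measurable (F t) (subprob_algebra sample_space)"
    by (rule measurable_compose[OF theta_adapted[OF assms] D_measurable])
  show "(\<lambda>\<omega>. isotropic_gaussian \<sigma>) \<in> measurable (F t) (subprob_algebra borel)"
    by (rule measurable_const)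
       (auto simp: space_subprob_algebra intro: prob_space_imp_subprob_space prob_space_isotropic_gaussian)
qed

text \<open>The sample and the noise have law \<open>kernel t\<close> given the past, and the state is known then, so
  one step may be averaged with the state held fixed.\<close>

lemma
  assumes t: "t < T"
  defines "step \<equiv> (\<lambda>\<omega>. \<integral>y. potential \<gamma> (dice_step \<gamma> C\<^sub>1 C\<^sub>2 (state t \<omega>) y) \<partial>kernel t \<omega>)"
  shows expectation_potential_Suc: "(\<integral>\<omega>. potential \<gamma> (state (Suc t) \<omega>) \<partial>\<Omega>) = (\<integral>\<omega>. step \<omega> \<partial>\<Omega>)"
    and integrable_step: "integrable \<Omega> step"
proof -
  let ?X = "\<lambda>\<omega>. (Z (Suc t) \<omega>, \<zeta> (Suc t) \<omega>)"
  let ?h = "\<lambda>y. potential \<gamma> (dice_step \<gamma> C\<^sub>1 C\<^sub>2 (fst y) (snd y))"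
  let ?G = "{A \<times> B | A B. A \<in> sets sample_space \<and> B \<in> sets (borel :: 'a measure)}"
  have "(\<lambda>\<omega>. ?X \<omega>) \<in> measurable (F (Suc t)) (sample_space \<Otimes>\<^sub>M borel)"
    using t by (intro measurable_Pair sample_measurable noise_measurable)
  hence X: "?X \<in> measurable \<Omega> (sample_space \<Otimes>\<^sub>M borel)"
    by (rule measurable_from_subalg[OF subalgebra_F])
  have law: "AE \<omega> in \<Omega>. real_cond_exp \<Omega> (F t) (\<lambda>\<omega>'. indicator Y (?X \<omega>')) \<omega> = measure (kernel t \<omega>) Y"
    if "Y \<in> ?G" for Y
  proof -
    from that obtain A B where Y: "Y = A \<times> B" and A: "A \<in> sets sample_space" and B: "B \<in> sets borel"
      by auto
    have "measure (kernel t \<omega>) Y = measure (D (\<theta> t \<omega>)) A * measure (isotropic_gaussian \<sigma>) B" for \<omega>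
    proof -
      interpret Np: prob_space "isotropic_gaussian \<sigma> :: 'a measure" by (rule prob_space_isotropic_gaussian)
      show ?thesis
        unfolding kernel_def Y measure_def
        using A B by (subst Np.emeasure_pair_measure_Times) (auto simp: enn2real_mult)
    qed
    thus ?thesis
      using draw_law[OF t A B] by (simp add: Y indicator_times)
  qed
  have G: "sets (sample_space \<Otimes>\<^sub>M (borel :: 'a measure)) = sigma_sets (space (sample_space \<Otimes>\<^sub>M (borel :: 'a measure))) ?G"
    by (simp add: sets_pair_measure space_pair_measure)
  have top: "space (sample_space \<Otimes>\<^sub>M (borel :: 'a measure)) \<in> ?G"
    using sets.top[of sample_space] sets.top[of "borel :: 'a measure"]
    unfolding space_pair_measure by blast
  have sub: "?G \<subseteq> Pow (space (sample_space \<Otimes>\<^sub>M (borel :: 'a measure)))"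
    using sets.sets_into_space[of _ sample_space] by (fastforce simp: space_pair_measure)
  have t': "t \<le> T" using t by simp
  note conditional_law = integral_conditional_law[OF prob_\<Omega> subalgebra_F state_adapted[OF t'] X
      kernel_measurable[OF t'] G Int_stable_pair_measure_generator top sub law
      potential_dice_step_measurable potential_bounded]
  have "(\<integral>\<omega>. ?h (state t \<omega>, ?X \<omega>) \<partial>\<Omega>) = (\<integral>\<omega>. (\<integral>y. ?h (state t \<omega>, y) \<partial>kernel t \<omega>) \<partial>\<Omega>)"
    by (rule conditional_law(1))
  moreover have "(\<integral>\<omega>. potential \<gamma> (state (Suc t) \<omega>) \<partial>\<Omega>) = (\<integral>\<omega>. ?h (state t \<omega>, ?X \<omega>) \<partial>\<Omega>)"
    by (intro Bochner_Integration.integral_cong) (auto simp: state_Suc[OF t])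
  ultimately show "(\<integral>\<omega>. potential \<gamma> (state (Suc t) \<omega>) \<partial>\<Omega>) = (\<integral>\<omega>. step \<omega> \<partial>\<Omega>)"
    by (simp add: step_def)
  have "integrable \<Omega> (\<lambda>\<omega>. \<integral>y. ?h (state t \<omega>, y) \<partial>kernel t \<omega>)"
    by (rule conditional_law(2))
  thus "integrable \<Omega> step" by (simp add: step_def)
qed

definition sq_grad :: "nat \<Rightarrow> real" where
  "sq_grad t = (\<integral>\<omega>. (norm (risk_grad l D (\<theta> t \<omega>) (\<theta> t \<omega>)))\<^sup>2 \<partial>\<Omega>)"

lemma integrable_sq_grad:
  assumes "t \<le> T"
  shows "integrable \<Omega> (\<lambda>\<omega>. (norm (risk_grad l D (\<theta> t \<omega>) (\<theta> t \<omega>)))\<^sup>2)"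
proof (rule integrable_const_bound[of _ "grad_bound\<^sup>2"])
  have "\<theta> t \<in> borel_measurable \<Omega>"
    by (rule measurable_from_subalg[OF subalgebra_F theta_adapted[OF assms]])
  from measurable_compose[OF this risk_grad_diagonal_measurable]
  show "(\<lambda>\<omega>. (norm (risk_grad l D (\<theta> t \<omega>) (\<theta> t \<omega>)))\<^sup>2) \<in> borel_measurable \<Omega>"
    by measurable
qed (auto intro!: AE_I2 power_mono risk_grad_bounded)

lemma integrable_potential: "t \<le> T \<Longrightarrow> integrable \<Omega> (\<lambda>\<omega>. potential \<gamma> (state t \<omega>))"
  using measurable_compose[OF state_measurable potential_measurable] potential_bounded
  by (intro integrable_const_bound[of _ l_max]) (auto intro!: AE_I2)

text \<open>The assumption on the errors concerns \<open>t \<ge> 1\<close>; at \<open>t = 0\<close> the error vanishes.\<close>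

lemma
  assumes "t < T"
  shows integrable_sq_error: "integrable \<Omega> (\<lambda>\<omega>. (norm (e t \<omega>))\<^sup>2)"
    and sq_error_le: "(\<integral>\<omega>. (norm (e t \<omega>))\<^sup>2 \<partial>\<Omega>) \<le> M\<^sup>2"
proof -
  have "integrable \<Omega> (\<lambda>\<omega>. (norm (e t \<omega>))\<^sup>2) \<and> (\<integral>\<omega>. (norm (e t \<omega>))\<^sup>2 \<partial>\<Omega>) \<le> M\<^sup>2"
  proof (cases "t = 0")
    case True
    have "integrable \<Omega> (\<lambda>\<omega>. (norm (e t \<omega>))\<^sup>2) \<longleftrightarrow> integrable \<Omega> (\<lambda>_. 0 :: real)"
      using True initial_error by (intro Bochner_Integration.integrable_cong) auto
    moreover have "(\<integral>\<omega>. (norm (e t \<omega>))\<^sup>2 \<partial>\<Omega>) = (\<integral>_. 0 \<partial>\<Omega>)"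
      using True initial_error by (intro Bochner_Integration.integral_cong) auto
    ultimately show ?thesis by simp
  next
    case False
    thus ?thesis using error assms by (auto simp: bounded_error_def)
  qed
  thus "integrable \<Omega> (\<lambda>\<omega>. (norm (e t \<omega>))\<^sup>2)" "(\<integral>\<omega>. (norm (e t \<omega>))\<^sup>2 \<partial>\<Omega>) \<le> M\<^sup>2" by auto
qed

definition step_error :: real where
  "step_error = L\<^sup>2 * \<gamma> ^ 3 * M\<^sup>2 + L / 2 * \<gamma>\<^sup>2 * (real DIM('a) * \<sigma>\<^sup>2 + \<sigma>\<^sub>0\<^sup>2)
     + 2 * l_max * \<beta> * \<gamma> * (C\<^sub>1 + C\<^sub>2 + sqrt (real DIM('a)) * \<sigma>)"

text \<open>The drift inequality holds for every state; here it is averaged over the state at time \<open>t\<close>, where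
  the bound on the second moment of the error enters.\<close>

lemma expectation_potential_descent:
  assumes step_size: "L * \<gamma> * (1 + \<sigma>\<^sub>1\<^sup>2) \<le> 1 / 2" and t: "t < T"
  shows "(\<integral>\<omega>. potential \<gamma> (state (Suc t) \<omega>) \<partial>\<Omega>)
    \<le> (\<integral>\<omega>. potential \<gamma> (state t \<omega>) \<partial>\<Omega>) - \<gamma> / 2 * sq_grad t + step_error"
proof -
  define c where "c = L / 2 * \<gamma>\<^sup>2 * (real DIM('a) * \<sigma>\<^sup>2 + \<sigma>\<^sub>0\<^sup>2)
     + 2 * l_max * \<beta> * \<gamma> * (C\<^sub>1 + C\<^sub>2 + sqrt (real DIM('a)) * \<sigma>)"
  define b where "b \<omega> = potential \<gamma> (state t \<omega>) - \<gamma> / 2 * (norm (risk_grad l D (\<theta> t \<omega>) (\<theta> t \<omega>)))\<^sup>2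
     + L\<^sup>2 * \<gamma> ^ 3 * (norm (e t \<omega>))\<^sup>2 + c" for \<omega>
  have int: "integrable \<Omega> (\<lambda>\<omega>. potential \<gamma> (state t \<omega>))"
      "integrable \<Omega> (\<lambda>\<omega>. (norm (risk_grad l D (\<theta> t \<omega>) (\<theta> t \<omega>)))\<^sup>2)"
      "integrable \<Omega> (\<lambda>\<omega>. (norm (e t \<omega>))\<^sup>2)"
    using integrable_potential[of t] integrable_sq_grad[of t] integrable_sq_error[OF t] t by auto
  have b_int: "integrable \<Omega> b" unfolding b_def using int by simp
  have "(\<integral>\<omega>. potential \<gamma> (state (Suc t) \<omega>) \<partial>\<Omega>) \<le> (\<integral>\<omega>. b \<omega> \<partial>\<Omega>)"
    unfolding expectation_potential_Suc[OF t]
    using expected_potential_dice_step_le[OF gamma_pos C1_nonneg C2_nonneg sigma_nonneg step_size]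
    by (intro integral_mono integrable_step[OF t] b_int) (simp add: b_def c_def state_def kernel_def)
  also have "\<dots> = (\<integral>\<omega>. potential \<gamma> (state t \<omega>) \<partial>\<Omega>) - \<gamma> / 2 * sq_grad t
      + L\<^sup>2 * \<gamma> ^ 3 * (\<integral>\<omega>. (norm (e t \<omega>))\<^sup>2 \<partial>\<Omega>) + c"
    unfolding b_def sq_grad_def using int prob_space by simp
  also have "L\<^sup>2 * \<gamma> ^ 3 * (\<integral>\<omega>. (norm (e t \<omega>))\<^sup>2 \<partial>\<Omega>) \<le> L\<^sup>2 * \<gamma> ^ 3 * M\<^sup>2"
    using gamma_pos by (intro mult_left_mono sq_error_le[OF t]) auto
  finally show ?thesis unfolding step_error_def c_def by linarith
qed

lemma init_gap_eq: "init_gap \<Omega> l D l_inf \<gamma> \<theta> e = (\<integral>\<omega>. potential \<gamma> (state 0 \<omega>) \<partial>\<Omega>) - l_inf"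
  using integrable_potential[of 0] prob_space
  by (simp add: init_gap_def potential_def state_def)

lemma init_gap_nonneg: "0 \<le> init_gap \<Omega> l D l_inf \<gamma> \<theta> e"
  and init_gap_le: "init_gap \<Omega> l D l_inf \<gamma> \<theta> e \<le> l_max - l_inf"
proof -
  have "l_inf \<le> (\<integral>\<omega>. potential \<gamma> (state 0 \<omega>) \<partial>\<Omega>)"
    using integrable_potential[of 0] risk_ge
    by (intro integral_ge_const) (auto intro!: AE_I2 simp: potential_def)
  moreover have "(\<integral>\<omega>. potential \<gamma> (state 0 \<omega>) \<partial>\<Omega>) \<le> l_max"
    using integrable_potential[of 0] potential_bounded
    by (intro integral_le_const) (auto intro!: AE_I2 simp: abs_le_iff)
  ultimately show "0 \<le> init_gap \<Omega> l D l_inf \<gamma> \<theta> e" "init_gap \<Omega> l D l_inf \<gamma> \<theta> e \<le> l_max - l_inf"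
    by (simp_all add: init_gap_eq)
qed

text \<open>The expected potentials telescope, since the potential at time \<open>Suc t\<close> is already taken under
  the newly deployed distribution.\<close>

lemma sum_sq_grad_le:
  assumes step_size: "L * \<gamma> * (1 + \<sigma>\<^sub>1\<^sup>2) \<le> 1 / 2"
  shows "\<gamma> / 2 * (\<Sum>t<T. sq_grad t) \<le> init_gap \<Omega> l D l_inf \<gamma> \<theta> e + real T * step_error"
proof -
  define a where "a t = (\<integral>\<omega>. potential \<gamma> (state t \<omega>) \<partial>\<Omega>)" for t
  have "\<gamma> / 2 * (\<Sum>t<T. sq_grad t) = (\<Sum>t<T. \<gamma> / 2 * sq_grad t)"
    by (rule sum_distrib_left)
  also have "\<dots> \<le> (\<Sum>t<T. (a t - a (Suc t)) + step_error)"
    using expectation_potential_descent[OF step_size] unfolding a_def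
    by (intro sum_mono) fastforce
  also have "\<dots> = a 0 - a T + real T * step_error"
    by (simp add: sum.distrib sum_lessThan_telescope')
  also have "l_inf \<le> a T"
    unfolding a_def using integrable_potential[of T] risk_ge
    by (intro integral_ge_const) (auto intro!: AE_I2 simp: potential_def)
  hence "a 0 - a T + real T * step_error \<le> init_gap \<Omega> l D l_inf \<gamma> \<theta> e + real T * step_error"
    unfolding init_gap_eq a_def by linarith
  finally show ?thesis .
qed

text \<open>The argument gives the constants \<open>2\<close> and \<open>L * \<gamma>\<close> in front of the initial gap and the variance
  terms; they are rounded up to \<open>4\<close> and \<open>2 * L * \<gamma>\<close> in the last step.\<close>

lemma min_sq_grad_le:
  assumes \<gamma>_le: "\<gamma> \<le> 1 / (2 * L * (1 + \<sigma>\<^sub>1\<^sup>2))" and T: "1 \<le> T"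
  shows "min_sq_grad \<Omega> l D \<theta> T
    \<le> 4 * init_gap \<Omega> l D l_inf \<gamma> \<theta> e / (real T * \<gamma>)
       + bias_const TYPE('a) l_max C\<^sub>1 C\<^sub>2 \<sigma> * \<beta>
       + 2 * L * \<gamma> * (real DIM('a) * \<sigma>\<^sup>2 + \<sigma>\<^sub>0\<^sup>2)
       + 2 * L\<^sup>2 * M\<^sup>2 * \<gamma>\<^sup>2"
proof -
  define m where "m = min_sq_grad \<Omega> l D \<theta> T"
  define \<Delta> where "\<Delta> = init_gap \<Omega> l D l_inf \<gamma> \<theta> e"
  define V where "V = real DIM('a) * \<sigma>\<^sup>2 + \<sigma>\<^sub>0\<^sup>2"
  have pos: "0 < 2 * L * (1 + \<sigma>\<^sub>1\<^sup>2)"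
    using L_pos by (intro mult_pos_pos) (auto intro: add_pos_nonneg)
  have step_size: "L * \<gamma> * (1 + \<sigma>\<^sub>1\<^sup>2) \<le> 1 / 2"
    using \<gamma>_le pos by (simp add: pos_le_divide_eq mult_ac)
  have m_le: "m \<le> sq_grad t" if "t < T" for t
    unfolding m_def min_sq_grad_def sq_grad_def using that by (intro Min_le) auto
  have "\<gamma> / 2 * (real T * m) \<le> \<gamma> / 2 * (\<Sum>t<T. sq_grad t)"
    using gamma_pos m_le sum_bounded_below[of "{..<T}" m sq_grad] by (intro mult_left_mono) auto
  also have "\<dots> \<le> \<Delta> + real T * step_error"
    unfolding \<Delta>_def by (rule sum_sq_grad_le[OF step_size])
  finally have "m \<le> 2 / \<gamma> * (\<Delta> / real T + step_error)"
    using gamma_pos T by (simp add: field_simps)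
  also have "\<dots> = 2 * \<Delta> / (real T * \<gamma>) + bias_const TYPE('a) l_max C\<^sub>1 C\<^sub>2 \<sigma> * \<beta>
      + L * \<gamma> * V + 2 * L\<^sup>2 * M\<^sup>2 * \<gamma>\<^sup>2"
    using gamma_pos
    by (simp add: step_error_def bias_const_def V_def field_simps power2_eq_square power3_eq_cube)
  also have "\<dots> \<le> 4 * \<Delta> / (real T * \<gamma>) + bias_const TYPE('a) l_max C\<^sub>1 C\<^sub>2 \<sigma> * \<beta>
      + 2 * L * \<gamma> * V + 2 * L\<^sup>2 * M\<^sup>2 * \<gamma>\<^sup>2"
  proof -
    have "2 * \<Delta> / (real T * \<gamma>) \<le> 4 * \<Delta> / (real T * \<gamma>)"
      using gamma_pos init_gap_nonneg unfolding \<Delta>_def by (intro divide_right_mono) auto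
    moreover have "0 \<le> L * \<gamma> * V"
      using L_pos gamma_pos by (simp add: V_def)
    ultimately show ?thesis by linarith
  qed
  finally show ?thesis unfolding m_def \<Delta>_def V_def .
qed

lemma bias_const_nonneg: "0 \<le> bias_const TYPE('a) l_max C\<^sub>1 C\<^sub>2 \<sigma>"
  using l_max_nonneg C1_nonneg C2_nonneg sigma_nonneg by (simp add: bias_const_def)

text \<open>With \<open>\<gamma> = 1 / sqrt T\<close> one has \<open>1 / (T * \<gamma>) = \<gamma>\<close> and \<open>\<gamma>\<^sup>2 \<le> \<gamma>\<close>, so every term other than the bias
  is a multiple of \<open>\<gamma>\<close>.  The initial gap is at most \<open>l_max - l_inf\<close>, which makes \<open>K\<close> independent of the
  run.\<close>

lemma min_sq_grad_rate:
  assumes \<gamma>_eq: "\<gamma> = 1 / sqrt (real T)" and T: "1 \<le> T" "(2 * L * (1 + \<sigma>\<^sub>1\<^sup>2))\<^sup>2 \<le> real T"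
  defines "K \<equiv> 1 + 4 * (l_max - l_inf) + 2 * L * (real DIM('a) * \<sigma>\<^sup>2 + \<sigma>\<^sub>0\<^sup>2) + 2 * L\<^sup>2 * M\<^sup>2"
  shows "min_sq_grad \<Omega> l D \<theta> T
    \<le> K * (1 / sqrt (real T) + bias_const TYPE('a) l_max C\<^sub>1 C\<^sub>2 \<sigma> * \<beta>)"
proof -
  define \<Delta> where "\<Delta> = init_gap \<Omega> l D l_inf \<gamma> \<theta> e"
  define V where "V = real DIM('a) * \<sigma>\<^sup>2 + \<sigma>\<^sub>0\<^sup>2"
  define B where "B = bias_const TYPE('a) l_max C\<^sub>1 C\<^sub>2 \<sigma> * \<beta>"
  have B: "0 \<le> B" unfolding B_def using bias_const_nonneg beta_nonneg by simp
  have V: "0 \<le> V" by (simp add: V_def)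
  have \<Delta>: "0 \<le> \<Delta>" "\<Delta> \<le> l_max - l_inf"
    unfolding \<Delta>_def by (rule init_gap_nonneg init_gap_le)+
  have pos: "0 < 2 * L * (1 + \<sigma>\<^sub>1\<^sup>2)"
    using L_pos by (intro mult_pos_pos) (auto intro: add_pos_nonneg)
  have "2 * L * (1 + \<sigma>\<^sub>1\<^sup>2) \<le> sqrt (real T)" using T(2) by (rule real_le_rsqrt)
  hence \<gamma>_le: "\<gamma> \<le> 1 / (2 * L * (1 + \<sigma>\<^sub>1\<^sup>2))"
    unfolding \<gamma>_eq by (intro divide_left_mono mult_pos_pos pos) (use T(1) in auto)
  have T\<gamma>: "1 / (real T * \<gamma>) = \<gamma>"
    using T(1) by (simp add: \<gamma>_eq field_simps)
  have "\<gamma> \<le> 1" using T(1) by (simp add: \<gamma>_eq)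
  hence \<gamma>2: "\<gamma>\<^sup>2 \<le> \<gamma>" using gamma_pos by (simp add: power2_eq_square mult_left_le)
  have "min_sq_grad \<Omega> l D \<theta> T \<le> 4 * \<Delta> * (1 / (real T * \<gamma>)) + B + 2 * L * \<gamma> * V + 2 * L\<^sup>2 * M\<^sup>2 * \<gamma>\<^sup>2"
    using min_sq_grad_le[OF \<gamma>_le T(1)] by (simp add: \<Delta>_def V_def B_def)
  also have "\<dots> \<le> 4 * (l_max - l_inf) * \<gamma> + B + 2 * L * V * \<gamma> + 2 * L\<^sup>2 * M\<^sup>2 * \<gamma>"
    unfolding T\<gamma> using \<Delta> \<gamma>2 gamma_pos
    by (intro add_mono mult_right_mono mult_left_mono) (auto simp: mult_ac)
  also have "\<dots> = (K - 1) * \<gamma> + B" by (simp add: K_def V_def algebra_simps)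
  also have "\<dots> \<le> K * \<gamma> + K * B"
  proof (intro add_mono mult_right_mono)
    have "0 \<le> 4 * (l_max - l_inf) + (2 * L * V + 2 * L\<^sup>2 * M\<^sup>2)"
      using \<Delta> V L_pos by (intro add_nonneg_nonneg) simp_all
    moreover have "K = 1 + (4 * (l_max - l_inf) + (2 * L * V + 2 * L\<^sup>2 * M\<^sup>2))"
      by (simp add: K_def V_def)
    ultimately have "1 \<le> K" by simp
    thus "B \<le> K * B" using B mult_right_mono[of 1 K B] by simp
  qed (use gamma_pos in auto)
  finally show ?thesis unfolding B_def \<gamma>_eq by (simp add: distrib_left)
qed

end

theorem theorem8:
  fixes L l_inf \<sigma>\<^sub>0 \<sigma>\<^sub>1 l_max \<sigma> M :: real
  shows
    "(\<forall>(S :: 'z::{real_normed_vector, second_countable_topology} set)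
        (l :: 'a::euclidean_space \<Rightarrow> 'z \<Rightarrow> real) (D :: 'a \<Rightarrow> 'z measure) \<beta> \<gamma> C\<^sub>1 C\<^sub>2 T
        (\<Omega> :: 'w measure) F \<theta> e Z \<zeta>.
        performative_assms S l D L l_inf \<sigma>\<^sub>0 \<sigma>\<^sub>1 \<beta> l_max \<longrightarrow>
        dice_sgd \<Omega> F S l D \<gamma> C\<^sub>1 C\<^sub>2 \<sigma> T \<theta> e Z \<zeta> \<longrightarrow>
        bounded_error \<Omega> e T M \<longrightarrow>
        \<gamma> \<le> 1 / (2 * L * (1 + \<sigma>\<^sub>1\<^sup>2)) \<longrightarrow> 1 \<le> T \<longrightarrow>
        min_sq_grad \<Omega> l D \<theta> T
          \<le> 4 * init_gap \<Omega> l D l_inf \<gamma> \<theta> e / (real T * \<gamma>)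
             + bias_const TYPE('a) l_max C\<^sub>1 C\<^sub>2 \<sigma> * \<beta>
             + 2 * L * \<gamma> * (real DIM('a) * \<sigma>\<^sup>2 + \<sigma>\<^sub>0\<^sup>2)
             + 2 * L\<^sup>2 * M\<^sup>2 * \<gamma>\<^sup>2)
     \<and>
     (\<exists>K T\<^sub>0. \<forall>(S :: 'z set) (l :: 'a \<Rightarrow> 'z \<Rightarrow> real) (D :: 'a \<Rightarrow> 'z measure) \<beta> C\<^sub>1 C\<^sub>2 T
        (\<Omega> :: 'w measure) F \<theta> e Z \<zeta>.
        performative_assms S l D L l_inf \<sigma>\<^sub>0 \<sigma>\<^sub>1 \<beta> l_max \<longrightarrow>
        dice_sgd \<Omega> F S l D (1 / sqrt (real T)) C\<^sub>1 C\<^sub>2 \<sigma> T \<theta> e Z \<zeta> \<longrightarrow>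
        bounded_error \<Omega> e T M \<longrightarrow>
        T\<^sub>0 \<le> T \<longrightarrow>
        min_sq_grad \<Omega> l D \<theta> T
          \<le> K * (1 / sqrt (real T) + bias_const TYPE('a) l_max C\<^sub>1 C\<^sub>2 \<sigma> * \<beta>))"
proof (intro conjI)
  have run: "dice_run S l D L l_inf \<sigma>\<^sub>0 \<sigma>\<^sub>1 \<beta> l_max \<Omega> F \<gamma> C\<^sub>1 C\<^sub>2 \<sigma> M T \<theta> e \<zeta> Z"
    if "performative_assms S l D L l_inf \<sigma>\<^sub>0 \<sigma>\<^sub>1 \<beta> l_max"
      and "dice_sgd \<Omega> F S l D \<gamma> C\<^sub>1 C\<^sub>2 \<sigma> T \<theta> e Z \<zeta>" and "bounded_error \<Omega> e T M"
    for S :: "'z set" and l :: "'a \<Rightarrow> 'z \<Rightarrow> real" and D \<beta> \<gamma> C\<^sub>1 C\<^sub>2 T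
      and \<Omega> :: "'w measure" and F \<theta> e Z \<zeta>
    using that by (simp add: dice_run_def dice_run_axioms_def performative_def)
  show "\<forall>(S :: 'z set) (l :: 'a \<Rightarrow> 'z \<Rightarrow> real) (D :: 'a \<Rightarrow> 'z measure) \<beta> \<gamma> C\<^sub>1 C\<^sub>2 T
        (\<Omega> :: 'w measure) F \<theta> e Z \<zeta>.
        performative_assms S l D L l_inf \<sigma>\<^sub>0 \<sigma>\<^sub>1 \<beta> l_max \<longrightarrow>
        dice_sgd \<Omega> F S l D \<gamma> C\<^sub>1 C\<^sub>2 \<sigma> T \<theta> e Z \<zeta> \<longrightarrow>
        bounded_error \<Omega> e T M \<longrightarrow>
        \<gamma> \<le> 1 / (2 * L * (1 + \<sigma>\<^sub>1\<^sup>2)) \<longrightarrow> 1 \<le> T \<longrightarrow>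
        min_sq_grad \<Omega> l D \<theta> T
          \<le> 4 * init_gap \<Omega> l D l_inf \<gamma> \<theta> e / (real T * \<gamma>)
             + bias_const TYPE('a) l_max C\<^sub>1 C\<^sub>2 \<sigma> * \<beta>
             + 2 * L * \<gamma> * (real DIM('a) * \<sigma>\<^sup>2 + \<sigma>\<^sub>0\<^sup>2)
             + 2 * L\<^sup>2 * M\<^sup>2 * \<gamma>\<^sup>2"
    by (intro allI impI dice_run.min_sq_grad_le[OF run])
  define K where "K = 1 + 4 * (l_max - l_inf) + 2 * L * (real DIM('a) * \<sigma>\<^sup>2 + \<sigma>\<^sub>0\<^sup>2) + 2 * L\<^sup>2 * M\<^sup>2"
  define T\<^sub>0 where "T\<^sub>0 = max 1 (nat \<lceil>(2 * L * (1 + \<sigma>\<^sub>1\<^sup>2))\<^sup>2\<rceil>)"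
  have T\<^sub>0: "1 \<le> T" "(2 * L * (1 + \<sigma>\<^sub>1\<^sup>2))\<^sup>2 \<le> real T" if "T\<^sub>0 \<le> T" for T
    using that unfolding T\<^sub>0_def by (auto simp: nat_le_iff ceiling_le_iff)
  show "\<exists>K T\<^sub>0. \<forall>(S :: 'z set) (l :: 'a \<Rightarrow> 'z \<Rightarrow> real) (D :: 'a \<Rightarrow> 'z measure) \<beta> C\<^sub>1 C\<^sub>2 T
        (\<Omega> :: 'w measure) F \<theta> e Z \<zeta>.
        performative_assms S l D L l_inf \<sigma>\<^sub>0 \<sigma>\<^sub>1 \<beta> l_max \<longrightarrow>
        dice_sgd \<Omega> F S l D (1 / sqrt (real T)) C\<^sub>1 C\<^sub>2 \<sigma> T \<theta> e Z \<zeta> \<longrightarrow>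
        bounded_error \<Omega> e T M \<longrightarrow>
        T\<^sub>0 \<le> T \<longrightarrow>
        min_sq_grad \<Omega> l D \<theta> T
          \<le> K * (1 / sqrt (real T) + bias_const TYPE('a) l_max C\<^sub>1 C\<^sub>2 \<sigma> * \<beta>)"
    by (rule exI[of _ K], rule exI[of _ T\<^sub>0], unfold K_def,
        intro allI impI dice_run.min_sq_grad_rate[OF run refl] T\<^sub>0)
qed

end
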